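(* Let $0<\alpha\le1$, $R>0$, and let $\psi\in\mathcal{S}(\mathbb{R}^n;C\ell_{0,n})$ be a radially symmetric function. Then the following statements are equivalent: (a) $\operatorname{supp}\widehat\psi\subseteq\overline{B(0,R)}$. (b) For each $m\in\mathbb{N}_0$ there exists a constant $0<\Lambda_{m,n}<\infty$ such that for all $k\in\mathbb{N}_0$ satisfying $\alpha k>2m+1-n$ we have $$\sup_{x\in\mathbb{R}^n}\left|(1+|x|^2)^m\left((-\Delta)^{\frac{\alpha}{2}}\right)^k\psi(x)\right|_0\le\Lambda_{m,n}\,R^{\alpha k}.$$
   Context: $C\ell_{0,n}$ is the Clifford algebra generated by $e_1,\dots,e_n$ with $e_je_k+e_ke_j=-2\delta_{jk}$, with complex coefficients allowed. Its elements are $\lambda=\sum_A\lambda_Ae_A$, $A\subseteq\{1,\dots,n\}$, with norm $|\lambda|_0=2^{n/2}\left(\sum_A|\lambda_A|^2\right)^{1/2}$. $\mathcal{S}(\mathbb{R}^n;C\ell_{0,n})$ is the space of Clifford-valued Schwartz functions (all components in $\mathcal{S}(\mathbb{R}^n)$). Radially symmetric means that $\psi(x)$ depends only on $|x|$. Fourier transform: $\widehat\psi(\xi)=\int_{\mathbb{R}^n}\psi(x)e^{-i\langle x,\xi\rangle}dx$. The operator $(-\Delta)^{\alpha/2}$ is the Fourier multiplier $\mathcal{F}\left((-\Delta)^{\alpha/2}\psi\right)(\xi)=|\xi|^\alpha\widehat\psi(\xi)$, so its $k$-th power has symbol $|\xi|^{\alpha k}$. $B(0,R)$ is the open Euclidean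 ball in $\mathbb{R}^n$. *)

theory Defs
  imports "HOL-Analysis.Analysis"
begin

section \<open>The complexified Clifford algebra\<close>

text \<open>
  The generators \<open>e\<^sub>j\<close> are indexed by a finite (linearly ordered) type; \<open>\<lambda> $ A\<close> is the coefficient of
  \<open>e\<^sub>A\<close>, the product of the \<open>e\<^sub>j\<close> with \<open>j \<in> A\<close> in increasing order. The type class instances of
  \<open>vec\<close> supply the vector space structure and topology; their pointwise product \<open>(*)\<close> is not the
  Clifford product, which is \<open>cl_mult\<close> below.
\<close>

type_synonym 'n clifford = "complex ^ ('n set)"

definition cl_basis :: "'n::finite set \<Rightarrow> 'n clifford" where
  "cl_basis A = axis A 1"

definition cl_gen :: "'n::finite \<Rightarrow> 'n clifford" where
  "cl_gen j = cl_basis {j}"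

definition cl_sign :: "'n::{finite,linorder} set \<Rightarrow> 'n set \<Rightarrow> complex" where
  "cl_sign A B = (\<Prod>a\<in>A. \<Prod>b\<in>B. if b \<le> a then -1 else 1)"

text \<open>
  Sorting \<open>e\<^sub>A e\<^sub>B\<close> moves each \<open>e\<^sub>b\<close> past the \<open>e\<^sub>a\<close> with \<open>b < a\<close>, each time changing the sign, and
  \<open>e\<^sub>a e\<^sub>a = -1\<close>. So \<open>e\<^sub>A e\<^sub>B = cl_sign A B \<cdot> e\<^bsub>sym_diff A B\<^esub>\<close>, see \<open>cl_mult_basis\<close>.
\<close>

definition cl_mult :: "'n::{finite,linorder} clifford \<Rightarrow> 'n clifford \<Rightarrow> 'n clifford" where
  "cl_mult x y = (\<chi> C. \<Sum>A\<in>UNIV. cl_sign A (sym_diff A C) * x $ A * y $ (sym_diff A C))"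

lemma sym_diff_cancel [simp]: "sym_diff A (sym_diff A C) = C"
  by auto

lemma cl_mult_basis:
  "cl_mult (cl_basis A) (cl_basis B) = cl_sign A B *s cl_basis (sym_diff A B)"
proof -
  have eq: "sym_diff A C = B \<longleftrightarrow> C = sym_diff A B" for C by auto
  have "(\<Sum>A'\<in>UNIV. cl_sign A' (sym_diff A' C) * axis A 1 $ A' * axis B 1 $ (sym_diff A' C))
      = (cl_sign A B *s axis (sym_diff A B) 1) $ C" for C
  proof -
    have "(\<Sum>A'\<in>UNIV. cl_sign A' (sym_diff A' C) * axis A 1 $ A' * axis B 1 $ (sym_diff A' C))
        = (\<Sum>A'\<in>UNIV. if A' = A then cl_sign A (sym_diff A C) * axis B 1 $ (sym_diff A C) else 0)"
      by (intro sum.cong) (auto simp: axis_def)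
    also have "\<dots> = cl_sign A (sym_diff A C) * axis B 1 $ (sym_diff A C)" by simp
    also have "\<dots> = (cl_sign A B *s axis (sym_diff A B) 1) $ C"
    proof (cases "C = sym_diff A B")
      case True
      then show ?thesis by (simp add: axis_def del: Un_Diff)
    next
      case False
      with eq[of C] show ?thesis by (simp add: axis_def del: Un_Diff)
    qed
    finally show ?thesis .
  qed
  then show ?thesis by (simp add: cl_mult_def cl_basis_def vec_eq_iff)
qed

lemma cl_gen_anticommute:
  "cl_mult (cl_gen j) (cl_gen k) + cl_mult (cl_gen k) (cl_gen j)
     = (if j = k then -2 else 0) *s cl_basis {}"
proof (cases "j = k")
  case True
  then show ?thesis
    by (simp add: cl_gen_def cl_mult_basis cl_sign_def vec_eq_iff)
next
  case False
  then have "sym_diff {j} {k} = {j, k}" "sym_diff {k} {j} = {j, k}" by auto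
  with False show ?thesis
    by (auto simp: cl_gen_def cl_mult_basis cl_sign_def vec_eq_iff)
qed

lemma cl_mult_one_left: "cl_mult (cl_basis {}) x = x"
  and cl_mult_one_right: "cl_mult x (cl_basis {}) = x"
proof -
  have "(\<Sum>A\<in>UNIV. cl_sign A (sym_diff A C) * axis {} 1 $ A * x $ (sym_diff A C))
      = (\<Sum>A\<in>UNIV. if A = ({} :: 'a set) then x $ C else 0)" for C
    by (rule sum.cong[OF refl]) (auto simp: axis_def cl_sign_def)
  then show "cl_mult (cl_basis {}) x = x"
    by (simp add: cl_mult_def cl_basis_def vec_eq_iff)
  have eq: "sym_diff A C = {} \<longleftrightarrow> A = C" for A C :: "'a set" by auto
  have "(\<Sum>A\<in>UNIV. cl_sign A (sym_diff A C) * x $ A * axis {} 1 $ (sym_diff A C))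
      = (\<Sum>A\<in>UNIV. if A = C then x $ C else 0)" for C
    by (rule sum.cong[OF refl]) (auto simp: axis_def cl_sign_def eq)
  then show "cl_mult x (cl_basis {}) = x"
    by (simp add: cl_mult_def cl_basis_def vec_eq_iff)
qed

lemma prod_sym_diff:
  fixes f :: "'b \<Rightarrow> complex"
  assumes "finite A" "finite B" "\<And>x. f x * f x = 1"
  shows "prod f (sym_diff A B) = prod f A * prod f B"
proof -
  have "prod f A = prod f (A - B) * prod f (A \<inter> B)"
    using assms prod.Int_Diff[of A f B] by (simp add: mult.commute)
  moreover have "prod f B = prod f (B - A) * prod f (A \<inter> B)"
    using assms prod.Int_Diff[of B f A] by (simp add: mult.commute Int_commute)
  moreover have "prod f (A \<inter> B) * prod f (A \<inter> B) = 1"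
    using assms by (simp flip: prod.distrib)
  moreover have "prod f (sym_diff A B) = prod f (A - B) * prod f (B - A)"
    using assms by (intro prod.union_disjoint) auto
  ultimately show ?thesis by (simp add: algebra_simps)
qed

lemma cl_sign_sym_diff_left: "cl_sign (sym_diff A B) C = cl_sign A C * cl_sign B C"
  unfolding cl_sign_def by (intro prod_sym_diff) (auto simp flip: prod.distrib intro!: prod.neutral)

lemma cl_sign_sym_diff_right: "cl_sign A (sym_diff B C) = cl_sign A B * cl_sign A C"
  unfolding cl_sign_def by (subst prod_sym_diff) (auto simp: prod.distrib)

lemma cl_mult_assoc: "cl_mult (cl_mult x y) z = cl_mult x (cl_mult y z)"
proof -
  have "(\<Sum>C\<in>UNIV. cl_sign C (sym_diff C D) *
           (\<Sum>A\<in>UNIV. cl_sign A (sym_diff A C) * x $ A * y $ (sym_diff A C)) * z $ (sym_diff C D))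
      = (\<Sum>A\<in>UNIV. cl_sign A (sym_diff A D) * x $ A *
           (\<Sum>B\<in>UNIV. cl_sign B (sym_diff B (sym_diff A D)) * y $ B * z $ (sym_diff B (sym_diff A D))))"
    (is "?L = ?R") for D
  proof -
    have "?L = (\<Sum>A\<in>UNIV. \<Sum>C\<in>UNIV. cl_sign C (sym_diff C D) *
           (cl_sign A (sym_diff A C) * x $ A * y $ (sym_diff A C)) * z $ (sym_diff C D))"
      unfolding sum_distrib_left sum_distrib_right by (rule sum.swap)
    also have "\<dots> = (\<Sum>A\<in>UNIV. \<Sum>B\<in>UNIV. cl_sign (sym_diff A B) (sym_diff B (sym_diff A D)) *
           (cl_sign A B * x $ A * y $ B) * z $ (sym_diff B (sym_diff A D)))"
    proof (rule sum.cong[OF refl])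
      fix A
      have swap: "sym_diff (sym_diff A B) D = sym_diff B (sym_diff A D)" for B by auto
      have bij: "bij_betw (sym_diff A) UNIV UNIV"
        by (rule bij_betwI[where g = "sym_diff A"]) (simp_all only: sym_diff_cancel UNIV_I Pi_I)
      show "(\<Sum>C\<in>UNIV. cl_sign C (sym_diff C D) *
           (cl_sign A (sym_diff A C) * x $ A * y $ (sym_diff A C)) * z $ (sym_diff C D))
         = (\<Sum>B\<in>UNIV. cl_sign (sym_diff A B) (sym_diff B (sym_diff A D)) *
           (cl_sign A B * x $ A * y $ B) * z $ (sym_diff B (sym_diff A D)))"
        by (subst sum.reindex_bij_betw[OF bij, symmetric]) (simp only: sym_diff_cancel swap)
    qed
    also have "\<dots> = ?R"
    proof (unfold sum_distrib_left, intro sum.cong refl)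
      fix A B
      have *: "sym_diff A D = sym_diff B (sym_diff B (sym_diff A D))" by auto
      have "cl_sign A (sym_diff A D) = cl_sign A B * cl_sign A (sym_diff B (sym_diff A D))"
        by (subst *) (rule cl_sign_sym_diff_right)
      then show "cl_sign (sym_diff A B) (sym_diff B (sym_diff A D)) *
           (cl_sign A B * x $ A * y $ B) * z $ (sym_diff B (sym_diff A D))
         = cl_sign A (sym_diff A D) * x $ A * (cl_sign B (sym_diff B (sym_diff A D)) * y $ B *
             z $ (sym_diff B (sym_diff A D)))"
        by (simp only: cl_sign_sym_diff_left mult_ac)
    qed
    finally show ?thesis .
  qed
  then show ?thesis by (simp only: cl_mult_def vec_eq_iff vec_lambda_beta) simp
qed

lemma cl_basis_insert:
  assumes "\<forall>a\<in>A. a < j"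
  shows "cl_basis (insert j A) = cl_mult (cl_basis A) (cl_gen j)"
proof -
  have "cl_sign A {j} = 1"
    using assms by (auto simp: cl_sign_def intro!: prod.neutral)
  moreover have "sym_diff A {j} = insert j A" using assms by auto
  ultimately show ?thesis by (simp add: cl_gen_def cl_mult_basis)
qed

definition cl_norm :: "'n::finite clifford \<Rightarrow> real" where
  "cl_norm x = 2 powr (real CARD('n) / 2) * sqrt (\<Sum>A\<in>UNIV. (cmod (x $ A))\<^sup>2)"


section \<open>Schwartz functions\<close>

definition partial_deriv :: "'n::finite \<Rightarrow> (real ^ 'n \<Rightarrow> complex) \<Rightarrow> real ^ 'n \<Rightarrow> complex" where
  "partial_deriv j f x = frechet_derivative f (at x) (axis j 1)"

fun partial_derivs :: "'n::finite list \<Rightarrow> (real ^ 'n \<Rightarrow> complex) \<Rightarrow> real ^ 'n \<Rightarrow> complex" where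
  "partial_derivs [] f = f"
| "partial_derivs (j # js) f = partial_deriv j (partial_derivs js f)"

text \<open>
  That all iterated partial derivatives are differentiable says that \<open>f\<close> is smooth, and it makes the
  underspecified \<open>frechet_derivative\<close> meaningful.
\<close>

definition schwartz :: "(real ^ 'n::finite \<Rightarrow> complex) \<Rightarrow> bool" where
  "schwartz f \<longleftrightarrow>
     (\<forall>js x. partial_derivs js f differentiable (at x)) \<and>
     (\<forall>js k. \<exists>C. \<forall>x. (1 + norm x) ^ k * cmod (partial_derivs js f x) \<le> C)"

definition clifford_schwartz :: "(real ^ 'n::finite \<Rightarrow> 'n clifford) \<Rightarrow> bool" where
  "clifford_schwartz \<psi> \<longleftrightarrow> (\<forall>A. schwartz (\<lambda>x. \<psi> x $ A))"

definition radially_symmetric :: "(real ^ 'n::finite \<Rightarrow> 'b) \<Rightarrow> bool" where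
  "radially_symmetric \<psi> \<longleftrightarrow> (\<forall>x y. norm x = norm y \<longrightarrow> \<psi> x = \<psi> y)"


section \<open>Fourier transform and fractional Laplacian\<close>

definition fourier :: "(real ^ 'n::finite \<Rightarrow> 'n clifford) \<Rightarrow> real ^ 'n \<Rightarrow> 'n clifford" where
  "fourier \<psi> \<xi> = (LINT x|lborel. exp (- \<i> * of_real (x \<bullet> \<xi>)) *s \<psi> x)"

definition inverse_fourier :: "(real ^ 'n::finite \<Rightarrow> 'n clifford) \<Rightarrow> real ^ 'n \<Rightarrow> 'n clifford" where
  "inverse_fourier \<phi> x =
     (1 / (2 * pi) ^ CARD('n)) *\<^sub>R (LINT \<xi>|lborel. exp (\<i> * of_real (x \<bullet> \<xi>)) *s \<phi> \<xi>)"

definition fourier_multiplier ::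
    "(real ^ 'n::finite \<Rightarrow> real) \<Rightarrow> (real ^ 'n \<Rightarrow> 'n clifford) \<Rightarrow> real ^ 'n \<Rightarrow> 'n clifford" where
  "fourier_multiplier \<sigma> \<psi> = inverse_fourier (\<lambda>\<xi>. \<sigma> \<xi> *\<^sub>R fourier \<psi> \<xi>)"

text \<open>
  The symbol of \<open>(-\<Delta>)\<^bsup>\<alpha>/2\<^esup>\<close> is \<open>\<bar>\<xi>\<bar>\<^sup>\<alpha>\<close>, and its \<open>k\<close>-th power is the multiplier whose symbol is the
  \<open>k\<close>-th power of that. The operator does not map Schwartz functions to Schwartz functions, so the
  power is taken on the symbol instead of iterating \<open>fourier_multiplier\<close>.
\<close>

definition frac_laplacian_power ::
    "real \<Rightarrow> nat \<Rightarrow> (real ^ 'n::finite \<Rightarrow> 'n clifford) \<Rightarrow> real ^ 'n \<Rightarrow> 'n clifford" where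
  "frac_laplacian_power \<alpha> k \<psi> = fourier_multiplier (\<lambda>\<xi>. (norm \<xi> powr \<alpha>) ^ k) \<psi>"

lemma frac_laplacian_symbol:
  assumes "\<xi> \<noteq> 0"
  shows "(norm \<xi> powr \<alpha>) ^ k = norm \<xi> powr (\<alpha> * real k)"
  using assms by (simp add: powr_powr powr_realpow flip: powr_realpow)

end

theory Submission
  imports Defs "HOL-Probability.Sinc_Integral" "HOL-Probability.Characteristic_Functions"
begin

text \<open>
  Work with the components \<open>f\<close> of \<open>\<psi>\<close>, let \<open>s = \<alpha> k\<close>, let \<open>F\<close> be the Fourier transform of \<open>f\<close>, and let \<open>h\<close>
  be the inverse transform of \<open>\<bar>\<xi>\<bar>\<^sup>s F\<close>.

  If \<open>F\<close> vanishes outside the ball, integrating by parts \<open>M = 2m\<close> times in \<open>\<xi>\<^sub>j\<close> bounds \<open>\<bar>x\<^sub>j\<bar>\<^sup>M \<bar>h x\<bar>\<close> by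
  integrals of terms \<open>s\<^sup>i \<bar>\<xi>\<bar>\<^bsup>s-i\<^esup> \<bar>\<partial>\<^sub>j\<^bsup>M-i\<^esup> F\<bar>\<close>. The powers \<open>s\<^sup>i\<close> are harmless since the derivatives of
  \<open>F\<close> are \<open>O((R - \<bar>\<xi>\<bar>)\<^sup>i)\<close> at the boundary and \<open>s\<^sup>i (1 - t)\<^sup>i t\<^sup>Q\<close> with \<open>Q = s - i + n - 1 > 0\<close> is bounded
  on \<open>[0, 1]\<close> uniformly in \<open>s\<close>. What is left is \<open>R\<^sup>s\<close> times the integral of \<open>\<bar>\<xi>\<bar>\<^bsup>1-n\<^esup>\<close> over the ball. The
  singularity at the origin is avoided by replacing \<open>\<bar>\<xi>\<bar>\<^sup>2\<close> with \<open>\<delta> + \<bar>\<xi>\<bar>\<^sup>2\<close> and letting \<open>\<delta>\<close> tend to \<open>0\<close>.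

  Conversely, the bound with \<open>m = n\<close> controls the \<open>L\<^sup>1\<close> norm of \<open>h\<close>, so Fourier inversion gives
  \<open>\<bar>\<xi>\<bar>\<^sup>s \<bar>F \<xi>\<bar> \<le> C R\<^sup>s\<close> for all large \<open>k\<close>, which forces \<open>F \<xi> = 0\<close> when \<open>\<bar>\<xi>\<bar> > R\<close>.
\<close>

section \<open>Integration on Euclidean space\<close>

text \<open>\<open>lborel\<close> is the image of a product of one-dimensional Lebesgue measures
  under the coordinate map, so Fubini applies. This serves the decaying weight, the singular weight
  and the Gaussian below.\<close>

lemma
  fixes f :: "'a::euclidean_space \<Rightarrow> real \<Rightarrow> 'b::{real_normed_field,banach,second_countable_topology}"
  assumes "\<And>b. b \<in> Basis \<Longrightarrow> integrable lborel (f b)"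
  shows integrable_lborel_prod: "integrable lborel (\<lambda>x::'a. \<Prod>b\<in>Basis. f b (x \<bullet> b))"
    and integral_lborel_prod:
      "(LINT x|lborel. (\<Prod>b\<in>Basis. f b (x \<bullet> b))) = (\<Prod>b\<in>Basis. LINT t|lborel. f b t)"
proof -
  interpret product_sigma_finite "\<lambda>_::'a. lborel :: real measure"
    by standard
  note [measurable] = borel_measurable_integrable[OF assms]
  have coord: "(\<Sum>c\<in>Basis. g c *\<^sub>R c) \<bullet> b = g b" if "b \<in> Basis" for g and b :: 'a
    using that by (simp add: inner_sum_left inner_Basis if_distrib sum.delta cong: if_cong)
  have meas: "(\<lambda>x::'a. \<Prod>b\<in>Basis. f b (x \<bullet> b)) \<in> borel_measurable borel"
    by (intro borel_measurable_prod) measurable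
  have "integrable (\<Pi>\<^sub>M b\<in>(Basis::'a set). lborel) (\<lambda>g. \<Prod>b\<in>Basis. f b (g b))"
    by (rule product_integrable_prod) (auto intro: assms)
  then show "integrable lborel (\<lambda>x::'a. \<Prod>b\<in>Basis. f b (x \<bullet> b))"
    by (subst lborel_eq, subst integrable_distr_eq) (use meas in \<open>auto simp: coord cong: prod.cong\<close>)
  have "(LINT x|lborel. (\<Prod>b\<in>Basis. f b (x \<bullet> b)))
      = (LINT g|(\<Pi>\<^sub>M b\<in>(Basis::'a set). lborel). (\<Prod>b\<in>Basis. f b (g b)))"
    by (subst lborel_eq, subst integral_distr) (use meas in \<open>auto simp: coord cong: prod.cong\<close>)
  also have "\<dots> = (\<Prod>b\<in>Basis. LINT t|lborel. f b t)"
    by (rule product_integral_prod) (auto intro: assms)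
  finally show "(LINT x|lborel. (\<Prod>b\<in>Basis. f b (x \<bullet> b))) = (\<Prod>b\<in>Basis. LINT t|lborel. f b t)" .
qed

text \<open>Each \<open>1 + (x \<bullet> b)\<^sup>2\<close> is at most
  \<open>1 + (norm x)\<^sup>2\<close>, so a product of one-dimensional functions 1 / (1 + t^2)
  dominates.\<close>

lemma integrable_inverse_1_plus_norm_square:
  "integrable lborel (\<lambda>x::'a::euclidean_space. 1 / (1 + (norm x)\<^sup>2) ^ DIM('a))"
proof (rule Bochner_Integration.integrable_bound)
  show "integrable lborel (\<lambda>x::'a. \<Prod>b\<in>Basis. inverse (1 + (x \<bullet> b)\<^sup>2))"
    using integrable_inverse_1_plus_square
    by (intro integrable_lborel_prod) (simp add: set_integrable_def)
  have prod_le: "(\<Prod>b\<in>Basis. 1 + (x \<bullet> b)\<^sup>2) \<le> (1 + (norm x)\<^sup>2) ^ DIM('a)" for x :: 'a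
  proof -
    have "(x \<bullet> b)\<^sup>2 \<le> (norm x)\<^sup>2" if "b \<in> Basis" for b
      using Basis_le_norm[OF that, of x] by (metis abs_le_square_iff abs_norm_cancel)
    then have "(\<Prod>b\<in>Basis. 1 + (x \<bullet> b)\<^sup>2) \<le> (\<Prod>b\<in>(Basis::'a set). 1 + (norm x)\<^sup>2)"
      by (intro prod_mono) (simp add: add_nonneg_nonneg)
    then show ?thesis by simp
  qed
  have prod_pos: "0 < (\<Prod>b\<in>Basis. 1 + (x \<bullet> b)\<^sup>2)" for x :: 'a
    by (intro prod_pos) (auto intro: add_pos_nonneg)
  have le: "1 / (1 + (norm x)\<^sup>2) ^ DIM('a) \<le> (\<Prod>b\<in>Basis. inverse (1 + (x \<bullet> b)\<^sup>2))" for x :: 'a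
    unfolding prod_inversef[unfolded o_def] divide_inverse mult_1
    by (rule le_imp_inverse_le[OF prod_le prod_pos])
  show "AE x::'a in lborel. norm (1 / (1 + (norm x)\<^sup>2) ^ DIM('a))
      \<le> norm (\<Prod>b\<in>Basis. inverse (1 + (x \<bullet> b)\<^sup>2))"
    using order.trans[OF le abs_ge_self] by (intro AE_I2) (simp add: add_nonneg_nonneg)
qed measurable

lemma integrable_abs_powr_Icc:
  fixes a r :: real
  assumes "a > -1"
  shows "integrable lborel (\<lambda>t. indicator {-r..r} t * \<bar>t\<bar> powr a)"
proof (cases "r \<ge> 0")
  case True
  have *: "integrable lborel (\<lambda>t. indicator {0..r} t * t powr a)"
  proof -
    have "(\<lambda>x. x powr a) integrable_on {0..r}"
      using has_integral_powr_from_0[OF assms True] by blast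
    then have "set_integrable lebesgue {0..r} (\<lambda>x. x powr a)"
      by (intro nonnegative_absolutely_integrable_1) auto
    then show ?thesis
      unfolding set_integrable_def by (subst (asm) integrable_completion) (auto simp: real_scaleR_def)
  qed
  have "integrable lborel (\<lambda>t. indicator {0..r} (0 + (-1) * t) * (0 + (-1) * t) powr a)"
    using * by (subst lborel_integrable_real_affine_iff) auto
  then have "integrable lborel (\<lambda>t. indicator {0..r} t * t powr a + indicator {0..r} (-t) * (-t) powr a)"
    using * by (intro Bochner_Integration.integrable_add) auto
  then show ?thesis
    by (rule Bochner_Integration.integrable_cong[THEN iffD1, rotated -1]) (auto simp: indicator_def)
next
  case False
  then show ?thesis by simp
qed

text \<open>Splitting the exponent evenly over the n coordinates replaces polar coordinates: with a
  = (1 - n) / n, |x|^(1-n) is a product of n factors |x|^a, and a <= 0 bounds each by the same power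
  of one coordinate. That power is locally integrable because a > -1.\<close>

lemma integrable_norm_powr_cball:
  "integrable lborel (\<lambda>x::'a::euclidean_space. indicator (cball 0 r) x * norm x powr (1 - real DIM('a)))"
proof (rule Bochner_Integration.integrable_bound)
  define a where "a = (1 - real DIM('a)) / real DIM('a)"
  have a: "a > -1" "a \<le> 0" "a * real DIM('a) = 1 - real DIM('a)"
    by (auto simp: a_def field_simps Suc_le_eq)
  show "integrable lborel (\<lambda>x::'a. \<Prod>b\<in>Basis. indicator {-r..r} (x \<bullet> b) * \<bar>x \<bullet> b\<bar> powr a)"
    by (intro integrable_lborel_prod integrable_abs_powr_Icc a)
  \<comment> \<open>Where a coordinate vanishes the comparison can fail, since
    \<open>0 powr a = 0\<close>; these hyperplanes are null sets.\<close>
  have coord0: "AE x in lborel. x \<bullet> b \<noteq> 0" if "b \<in> Basis" for b :: 'a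
  proof -
    have "{x::'a. x \<bullet> b = 0} \<in> null_sets lborel"
      using negligible_standard_hyperplane[OF that, of 0]
      by (auto simp: negligible_iff_null_sets null_sets_def sets_completionI_sets)
    then show ?thesis by (auto dest: AE_not_in)
  qed
  then have "AE x in lborel. \<forall>b\<in>(Basis::'a set). x \<bullet> b \<noteq> 0"
    by (simp add: AE_finite_all)
  then show "AE x::'a in lborel. norm (indicator (cball 0 r) x * norm x powr (1 - real DIM('a)))
      \<le> norm (\<Prod>b\<in>(Basis::'a set). indicator {-r..r} (x \<bullet> b) * \<bar>x \<bullet> b\<bar> powr a)"
  proof eventually_elim
    case (elim x)
    show ?case
    proof (cases "norm x \<le> r")
      case True
      have le: "\<bar>x \<bullet> b\<bar> \<le> norm x" if "b \<in> Basis" for b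
        using Basis_le_norm[OF that] .
      have "norm x \<noteq> 0" using elim by (auto dest: nonempty_Basis[THEN ex_in_conv[THEN iffD2], THEN exE])
      then have "norm x powr (1 - real DIM('a)) = (\<Prod>b\<in>(Basis::'a set). norm x powr a)"
        by (simp add: powr_powr flip: a(3) powr_realpow)
      also have "\<dots> \<le> (\<Prod>b\<in>(Basis::'a set). \<bar>x \<bullet> b\<bar> powr a)"
        using elim le a(2) by (intro prod_mono conjI powr_mono2') auto
      also have "\<dots> = (\<Prod>b\<in>(Basis::'a set). indicator {-r..r} (x \<bullet> b) * \<bar>x \<bullet> b\<bar> powr a)"
      proof (rule prod.cong[OF refl])
        fix b :: 'a assume "b \<in> Basis"
        from le[OF this] True have "x \<bullet> b \<in> {-r..r}" by auto
        then show "\<bar>x \<bullet> b\<bar> powr a = indicator {-r..r} (x \<bullet> b) * \<bar>x \<bullet> b\<bar> powr a" by simp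
      qed
      finally show ?thesis
        using True by (auto simp: abs_prod intro!: order.trans[OF _ abs_ge_self])
    qed auto
  qed
qed (auto intro!: borel_measurable_times borel_measurable_indicator)

section \<open>Affine substitutions and integration by parts\<close>

lemma integrable_affine:
  fixes f :: "'a::euclidean_space \<Rightarrow> 'b::{banach,second_countable_topology}"
  assumes f: "integrable lborel f" and c: "c \<noteq> 0"
  shows "integrable lborel (\<lambda>x. f (t + c *\<^sub>R x))"
    and "(LINT x|lborel. f (t + c *\<^sub>R x)) = (LINT x|lborel. f x) /\<^sub>R \<bar>c\<bar> ^ DIM('a)"
proof -
  have [measurable]: "f \<in> borel_measurable borel"
    using f by auto
  have "integrable (density (distr lborel borel (\<lambda>x. t + c *\<^sub>R x)) (\<lambda>_. \<bar>c\<bar> ^ DIM('a))) f"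
    using f lborel_affine[OF c, of t] by simp
  then have "integrable lborel (\<lambda>x. \<bar>c\<bar> ^ DIM('a) *\<^sub>R f (t + c *\<^sub>R x))"
    by (subst (asm) integrable_density, simp, simp, simp) (subst (asm) integrable_distr_eq, auto)
  then have "integrable lborel (\<lambda>x. inverse (\<bar>c\<bar> ^ DIM('a)) *\<^sub>R \<bar>c\<bar> ^ DIM('a) *\<^sub>R f (t + c *\<^sub>R x))"
    by (rule integrable_scaleR_right)
  then show "integrable lborel (\<lambda>x. f (t + c *\<^sub>R x))"
    using c unfolding scaleR_scaleR by simp
  have "(LINT x|lborel. f x) = (LINT x|density (distr lborel borel (\<lambda>x. t + c *\<^sub>R x)) (\<lambda>_. \<bar>c\<bar> ^ DIM('a)). f x)"
    using lborel_affine[OF c, of t] by simp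
  also have "\<dots> = (LINT x|lborel. \<bar>c\<bar> ^ DIM('a) *\<^sub>R f (t + c *\<^sub>R x))"
    by (subst integral_density, simp, simp, simp) (subst integral_distr, auto)
  finally show "(LINT x|lborel. f (t + c *\<^sub>R x)) = (LINT x|lborel. f x) /\<^sub>R \<bar>c\<bar> ^ DIM('a)"
    using c by simp
qed

lemma integrable_translate:
  fixes f :: "'a::euclidean_space \<Rightarrow> 'b::{banach,second_countable_topology}"
  assumes "integrable lborel f"
  shows "integrable lborel (\<lambda>x. f (x + t))" and "(LINT x|lborel. f (x + t)) = (LINT x|lborel. f x)"
  using integrable_affine[OF assms, of 1 t] by (simp_all add: add.commute)

text \<open>
  By Fubini and translation invariance, the integral of \<open>f'\<close> equals that of
  \<open>f (x + e) - f x = \<integral>\<^sub>0\<^sup>1 f' (x + t e) dt\<close>, so no decomposition of the space along \<open>e\<close> is needed.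
\<close>

lemma integral_directional_derivative_eq_0:
  fixes f f' :: "'a::euclidean_space \<Rightarrow> 'b::euclidean_space"
  assumes f: "integrable lborel f" and f': "integrable lborel f'"
    and deriv: "\<And>x. ((\<lambda>t. f (x + t *\<^sub>R e)) has_vector_derivative f' x) (at 0)"
  shows "(LINT x|lborel. f' x) = 0"
proof -
  have [measurable]: "f' \<in> borel_measurable borel"
    using f' by auto
  define g where "g = (\<lambda>(t::real, x). indicator {0..1} t *\<^sub>R f' (x + t *\<^sub>R e))"
  have [measurable]: "g \<in> borel_measurable (lborel \<Otimes>\<^sub>M lborel)"
    unfolding g_def by measurable
  have g: "integrable (lborel \<Otimes>\<^sub>M lborel) (\<lambda>(t, x). g (t, x))"
  proof (rule lborel_pair.Fubini_integrable)
    have "(LINT x|lborel. norm (g (t, x))) = indicator {0..1} t * (LINT x|lborel. norm (f' x))" for t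
      using integrable_translate(2)[OF integrable_norm[OF f'], of "t *\<^sub>R e"] by (simp add: g_def)
    then show "integrable lborel (\<lambda>t. LINT x|lborel. norm (case (t, x) of (t, x) \<Rightarrow> g (t, x)))"
      by simp
    show "AE t in lborel. integrable lborel (\<lambda>x. case (t, x) of (t, x) \<Rightarrow> g (t, x))"
      by (intro AE_I2) (auto simp: g_def intro!: integrable_scaleR_right integrable_translate f')
  qed measurable
  have inner: "AE x in lborel. (LINT t|lborel. g (t, x)) = f (x + e) - f x"
    using lborel_pair.AE_integrable_snd[OF g]
  proof eventually_elim
    case (elim x)
    have line: "((\<lambda>t. f (x + t *\<^sub>R e)) has_vector_derivative f' (x + t *\<^sub>R e)) (at t within {0..1})" for t
    proof -
      have "((\<lambda>u. f ((x + t *\<^sub>R e) + u *\<^sub>R e)) has_vector_derivative f' (x + t *\<^sub>R e)) (at (t - t))"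
        using deriv by simp
      then have "((\<lambda>u. f ((x + t *\<^sub>R e) + u *\<^sub>R e)) \<circ> (\<lambda>u. u - t) has_vector_derivative
          1 *\<^sub>R f' (x + t *\<^sub>R e)) (at t)"
        by (intro vector_diff_chain_at) (auto intro!: derivative_eq_intros simp: has_vector_derivative_diff_const)
      then show ?thesis
        by (simp add: o_def algebra_simps has_vector_derivative_at_within)
    qed
    \<comment> \<open>As \<open>f'\<close> need not be continuous, the fundamental theorem yields a
      gauge integral. Fubini makes almost every slice Lebesgue integrable, and there the two
      integrals agree.\<close>
    have "((\<lambda>t. f' (x + t *\<^sub>R e)) has_integral f (x + 1 *\<^sub>R e) - f (x + 0 *\<^sub>R e)) {0..1}"
      by (rule fundamental_theorem_of_calculus) (use line in auto)
    moreover have "set_integrable lborel {0..1} (\<lambda>t. f' (x + t *\<^sub>R e))"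
      using elim by (simp add: set_integrable_def g_def)
    ultimately have "(LINT t:{0..1}|lborel. f' (x + t *\<^sub>R e)) = f (x + e) - f x"
      using set_borel_integral_eq_integral(2)[of "{0..1}" "\<lambda>t. f' (x + t *\<^sub>R e)"] by (auto dest: integral_unique)
    then show ?case by (simp add: set_lebesgue_integral_def g_def)
  qed
  have "(LINT x|lborel. f' x) = (LINT t|lborel. indicator {0..1::real} t *\<^sub>R (LINT x|lborel. f' x))"
    by simp
  also have "\<dots> = (LINT t|lborel. LINT x|lborel. g (t, x))"
    using integrable_translate(2)[OF f'] by (simp add: g_def)
  also have "\<dots> = (LINT x|lborel. LINT t|lborel. g (t, x))"
    using lborel_pair.Fubini_integral[OF g] by simp
  also have "\<dots> = (LINT x|lborel. f (x + e) - f x)"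
    by (rule integral_cong_AE) (use inner f in auto)
  also have "\<dots> = 0"
    using integrable_translate[OF f, of e] f by simp
  finally show ?thesis .
qed

section \<open>Fourier transforms of rapidly decreasing functions\<close>

text \<open>Smoothness is left out on purpose: multiplying a transform by |\<xi>|^s keeps rapid
  decay but can destroy smoothness at the origin.\<close>

definition rapidly_decreasing :: "('a::euclidean_space \<Rightarrow> complex) \<Rightarrow> bool" where
  "rapidly_decreasing f \<longleftrightarrow>
     f \<in> borel_measurable borel \<and> (\<forall>N::nat. \<exists>C. \<forall>x. (1 + norm x) ^ N * cmod (f x) \<le> C)"

definition ft :: "('a::euclidean_space \<Rightarrow> complex) \<Rightarrow> 'a \<Rightarrow> complex" where
  "ft f \<xi> = (LINT x|lborel. exp (- \<i> * of_real (x \<bullet> \<xi>)) * f x)"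

lemma rapidly_decreasing_measurable [measurable_dest]:
  "rapidly_decreasing f \<Longrightarrow> f \<in> borel_measurable borel"
  by (simp add: rapidly_decreasing_def)

lemma rapidly_decreasing_mult:
  assumes f: "rapidly_decreasing f" and g: "g \<in> borel_measurable borel"
    and bound: "\<And>x. cmod (g x) \<le> c * (1 + norm x) ^ k"
  shows "rapidly_decreasing (\<lambda>x. g x * f x)"
  unfolding rapidly_decreasing_def
proof (intro conjI allI)
  show "(\<lambda>x. g x * f x) \<in> borel_measurable borel"
    using f g by measurable
  fix N
  obtain C where C: "(1 + norm x) ^ (N + k) * cmod (f x) \<le> C" for x
    using f unfolding rapidly_decreasing_def by blast
  have c: "c \<ge> 0"
    using order.trans[OF norm_ge_zero bound[of 0]] by simp
  have "(1 + norm x) ^ N * cmod (g x * f x) \<le> c * C" for x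
  proof -
    have "(1 + norm x) ^ N * cmod (g x * f x)
        \<le> (1 + norm x) ^ N * ((c * (1 + norm x) ^ k) * cmod (f x))"
      unfolding norm_mult by (intro mult_left_mono mult_right_mono bound) auto
    also have "\<dots> = c * ((1 + norm x) ^ (N + k) * cmod (f x))"
      by (simp add: power_add)
    also have "\<dots> \<le> c * C"
      by (intro mult_left_mono C c)
    finally show ?thesis .
  qed
  then show "\<exists>C. \<forall>x. (1 + norm x) ^ N * cmod (g x * f x) \<le> C"
    by blast
qed

text \<open>These factors are what differentiating \<open>ft f\<close> along \<open>e\<close> brings
  down under the integral.\<close>

lemma rapidly_decreasing_moment:
  assumes "rapidly_decreasing f"
  shows "rapidly_decreasing (\<lambda>x. (- \<i> * of_real (x \<bullet> e)) ^ q * f x)"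
proof (rule rapidly_decreasing_mult[OF assms])
  show "cmod ((- \<i> * of_real (x \<bullet> e)) ^ q) \<le> norm e ^ q * (1 + norm x) ^ q" for x
  proof -
    have "\<bar>x \<bullet> e\<bar> \<le> norm e * (1 + norm x)"
      using Cauchy_Schwarz_ineq2[of x e] by (simp add: algebra_simps add_increasing)
    from power_mono[OF this] show ?thesis
      by (simp add: norm_mult norm_power power_mult_distrib)
  qed
qed measurable

lemma rapidly_decreasing_integrable:
  fixes f :: "'a::euclidean_space \<Rightarrow> complex"
  assumes "rapidly_decreasing f"
  shows "integrable lborel f"
proof -
  obtain C where C: "(1 + norm x) ^ (2 * DIM('a)) * cmod (f x) \<le> C" for x
    using assms unfolding rapidly_decreasing_def by blast
  show ?thesis
  proof (rule Bochner_Integration.integrable_bound)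
    show "integrable lborel (\<lambda>x::'a. C * (1 / (1 + (norm x)\<^sup>2) ^ DIM('a)))"
      by (intro integrable_mult_right integrable_inverse_1_plus_norm_square)
    have "cmod (f x) \<le> C * (1 / (1 + (norm x)\<^sup>2) ^ DIM('a))" for x
    proof -
      have "(1 + (norm x)\<^sup>2) ^ DIM('a) \<le> ((1 + norm x)\<^sup>2) ^ DIM('a)"
        by (intro power_mono) (auto simp: power2_sum)
      then have "(1 + (norm x)\<^sup>2) ^ DIM('a) * cmod (f x) \<le> C"
        using C[of x] mult_right_mono[OF _ norm_ge_zero[of "f x"]]
        by (metis (no_types, opaque_lifting) order.trans power_mult)
      moreover have "(1 + (norm x)\<^sup>2) ^ DIM('a) > 0"
        by (intro zero_less_power add_pos_nonneg) auto
      ultimately show ?thesis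
        by (simp add: field_simps)
    qed
    then show "AE x::'a in lborel. norm (f x) \<le> norm (C * (1 / (1 + (norm x)\<^sup>2) ^ DIM('a)))"
      by (intro AE_I2) (metis order.trans real_norm_def abs_ge_self)
  qed (use assms in measurable)
qed

lemma cmod_exp_i [simp]: "cmod (exp (\<i> * of_real t)) = 1" "cmod (exp (- (\<i> * of_real t))) = 1"
  by (simp_all add: norm_exp_eq_Re)

lemma integrable_character_mult:
  fixes f :: "'a::euclidean_space \<Rightarrow> complex"
  assumes "integrable lborel f"
  shows "integrable lborel (\<lambda>x. exp (- \<i> * of_real (x \<bullet> \<xi>)) * f x)"
    and "integrable lborel (\<lambda>x. exp (\<i> * of_real (\<xi> \<bullet> x)) * f x)"
  using assms by (auto intro!: Bochner_Integration.integrable_bound[OF assms] simp: norm_mult)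

lemma norm_ft_le:
  assumes "integrable lborel f"
  shows "cmod (ft f \<xi>) \<le> (LINT x|lborel. cmod (f x))"
  unfolding ft_def by (rule order.trans[OF integral_norm_bound]) (simp add: norm_mult)

lemma ft_diff:
  assumes "integrable lborel f" "integrable lborel g"
  shows "ft (\<lambda>x. f x - g x) \<xi> = ft f \<xi> - ft g \<xi>"
  unfolding ft_def using integrable_character_mult(1)[OF assms(1)] integrable_character_mult(1)[OF assms(2)]
  by (simp add: right_diff_distrib)

text \<open>Turns difference quotients and finite differences of \<open>ft f\<close> into transforms
  of explicit functions.\<close>

lemma ft_shift: "ft f (\<xi> + \<eta>) = ft (\<lambda>x. exp (- \<i> * of_real (x \<bullet> \<eta>)) * f x) \<xi>"
proof -
  have "exp (- \<i> * of_real (x \<bullet> (\<xi> + \<eta>)))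
      = exp (- \<i> * of_real (x \<bullet> \<xi>)) * exp (- \<i> * of_real (x \<bullet> \<eta>))" for x
    unfolding exp_add[symmetric] by (simp add: inner_add_right algebra_simps)
  then show ?thesis
    by (simp add: ft_def mult.assoc)
qed

lemma has_vector_derivative_at_0I:
  fixes g :: "real \<Rightarrow> 'b::real_normed_vector"
  assumes "\<And>t. norm (g t - g 0 - t *\<^sub>R D) \<le> C * t\<^sup>2"
  shows "(g has_vector_derivative D) (at 0)"
  unfolding has_vector_derivative_def has_derivative_at
proof
  show "(\<lambda>h. norm (g (0 + h) - g 0 - h *\<^sub>R D) / norm h) \<midarrow>0\<rightarrow> 0"
  proof (rule Lim_null_comparison)
    have "norm (norm (g (0 + h) - g 0 - h *\<^sub>R D) / norm h) \<le> C * \<bar>h\<bar>" if "h \<noteq> 0" for h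
    proof -
      have "h\<^sup>2 = \<bar>h\<bar> * \<bar>h\<bar>"
        by (simp add: power2_eq_square)
      then show ?thesis
        using assms[of h] that by (simp add: divide_le_eq mult.assoc)
    qed
    then show "\<forall>\<^sub>F h in at 0. norm (norm (g (0 + h) - g 0 - h *\<^sub>R D) / norm h) \<le> C * \<bar>h\<bar>"
      by (auto simp: eventually_at_filter)
    show "((\<lambda>h. C * \<bar>h\<bar>) \<longlongrightarrow> 0) (at 0)"
      by (rule tendsto_eq_intros | simp)+
  qed
qed (rule bounded_linear_scaleR_left)

text \<open>By \<open>ft_shift\<close> the remainder is the transform of \<open>f\<close> times the
  first-order Taylor remainder of exp(-i t x.e). That factor is at most (t x.e)^2, so a second
  moment of \<open>f\<close> serves as the constant in
  \<open>has_vector_derivative_at_0I\<close>.\<close>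

lemma has_vector_derivative_ft:
  fixes f :: "'a::euclidean_space \<Rightarrow> complex"
  assumes f: "rapidly_decreasing f"
  shows "((\<lambda>t. ft f (\<xi> + t *\<^sub>R e)) has_vector_derivative ft (\<lambda>x. - \<i> * of_real (x \<bullet> e) * f x) \<xi>) (at 0)"
proof (rule has_vector_derivative_at_0I)
  fix t :: real
  have int: "integrable lborel f" "integrable lborel (\<lambda>x. - \<i> * of_real (x \<bullet> e) * f x)"
      "integrable lborel (\<lambda>x. (- \<i> * of_real (x \<bullet> e)) ^ 2 * f x)"
    using rapidly_decreasing_integrable[OF f]
      rapidly_decreasing_integrable[OF rapidly_decreasing_moment[OF f, of e 1]]
      rapidly_decreasing_integrable[OF rapidly_decreasing_moment[OF f, of e 2]]
    by simp_all
  define h where "h = (\<lambda>x. exp (- \<i> * of_real (x \<bullet> (t *\<^sub>R e))) * f x - f x - of_real t * (- \<i> * of_real (x \<bullet> e) * f x))"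
  have h: "integrable lborel h"
    unfolding h_def by (intro Bochner_Integration.integrable_diff integrable_character_mult integrable_mult_right int)
  have "ft f (\<xi> + t *\<^sub>R e) - ft f (\<xi> + 0 *\<^sub>R e) - t *\<^sub>R ft (\<lambda>x. - \<i> * of_real (x \<bullet> e) * f x) \<xi> = ft h \<xi>"
  proof -
    have "t *\<^sub>R ft (\<lambda>x. - \<i> * of_real (x \<bullet> e) * f x) \<xi> = ft (\<lambda>x. of_real t * (- \<i> * of_real (x \<bullet> e) * f x)) \<xi>"
      unfolding ft_def scaleR_conv_of_real
      by (subst integral_mult_right_zero[symmetric]) (simp add: mult_ac)
    then show ?thesis
      unfolding h_def ft_shift[of _ _ "t *\<^sub>R e"] using int
      by (subst ft_diff, intro Bochner_Integration.integrable_diff integrable_character_mult int, intro integrable_mult_right int)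
        (subst ft_diff, intro integrable_character_mult int, intro int, simp)
  qed
  also have "cmod (ft h \<xi>) \<le> (LINT x|lborel. cmod (h x))"
    by (rule norm_ft_le[OF h])
  also have "\<dots> \<le> (LINT x|lborel. t\<^sup>2 * cmod ((- \<i> * of_real (x \<bullet> e)) ^ 2 * f x))"
  proof (rule integral_mono)
    show "cmod (h x) \<le> t\<^sup>2 * cmod ((- \<i> * of_real (x \<bullet> e)) ^ 2 * f x)" for x
    proof -
      define c :: complex where "c = exp (\<i> * of_real (- t * (x \<bullet> e)))"
      have "h x = (c - (\<Sum>k\<le>1. (\<i> * of_real (- t * (x \<bullet> e))) ^ k / fact k)) * f x"
      proof -
        have "exp (- \<i> * of_real (x \<bullet> (t *\<^sub>R e))) = c"
          by (simp add: c_def)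
        then show ?thesis
          by (simp add: h_def algebra_simps)
      qed
      moreover have "cmod (c - (\<Sum>k\<le>1. (\<i> * of_real (- t * (x \<bullet> e))) ^ k / fact k))
          \<le> \<bar>- t * (x \<bullet> e)\<bar>\<^sup>2"
        using iexp_approx1[of "- t * (x \<bullet> e)" 1] unfolding c_def
        by (rule order.trans) (use zero_le_square[of "t * (x \<bullet> e)"] in \<open>simp add: power2_eq_square mult_ac\<close>)
      ultimately show ?thesis
        using mult_right_mono[OF _ norm_ge_zero[of "f x"]]
        by (simp only: norm_mult norm_power norm_of_real norm_minus_cancel norm_ii abs_mult abs_minus_cancel power_mult_distrib power2_abs mult.assoc[symmetric] mult_1_left one_power2 mult_1_right)
    qed
  qed (use h int in auto)
  also have "\<dots> = (LINT x|lborel. cmod ((- \<i> * of_real (x \<bullet> e)) ^ 2 * f x)) * t\<^sup>2"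
    by simp
  finally show "cmod (ft f (\<xi> + t *\<^sub>R e) - ft f (\<xi> + 0 *\<^sub>R e) - t *\<^sub>R ft (\<lambda>x. - \<i> * of_real (x \<bullet> e) * f x) \<xi>)
      \<le> (LINT x|lborel. cmod ((- \<i> * of_real (x \<bullet> e)) ^ 2 * f x)) * t\<^sup>2" .
qed

lemma continuous_on_ft:
  fixes f :: "'a::euclidean_space \<Rightarrow> complex"
  assumes f: "integrable lborel f"
  shows "continuous_on UNIV (ft f)"
  unfolding continuous_on_sequentially o_def ft_def
proof (intro allI ballI impI, elim conjE)
  fix X :: "nat \<Rightarrow> 'a" and \<xi> assume X: "X \<longlonglongrightarrow> \<xi>"
  have [measurable]: "f \<in> borel_measurable borel"
    using f by auto
  show "(\<lambda>n. LINT x|lborel. exp (- \<i> * of_real (x \<bullet> X n)) * f x)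
      \<longlonglongrightarrow> (LINT x|lborel. exp (- \<i> * of_real (x \<bullet> \<xi>)) * f x)"
    by (rule integral_dominated_convergence[where w = "\<lambda>x. cmod (f x)"])
      (auto intro!: tendsto_intros X f simp: norm_mult)
qed

text \<open>Integration by parts: \<open>g\<close> is the derivative along \<open>e\<close> of the
  character times \<open>f\<close>, so its integral vanishes.\<close>

lemma ft_directional_derivative:
  fixes f f' :: "'a::euclidean_space \<Rightarrow> complex"
  assumes f: "integrable lborel f" and f': "integrable lborel f'"
    and deriv: "\<And>x. ((\<lambda>t. f (x + t *\<^sub>R e)) has_vector_derivative f' x) (at 0)"
  shows "ft f' \<xi> = \<i> * of_real (\<xi> \<bullet> e) * ft f \<xi>"
proof -
  define g where "g = (\<lambda>x. exp (- \<i> * of_real (x \<bullet> \<xi>)) * f' x -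
      \<i> * of_real (\<xi> \<bullet> e) * (exp (- \<i> * of_real (x \<bullet> \<xi>)) * f x))"
  have "(LINT x|lborel. g x) = 0"
  proof (rule integral_directional_derivative_eq_0)
    show "integrable lborel (\<lambda>x. exp (- \<i> * of_real (x \<bullet> \<xi>)) * f x)"
      by (rule integrable_character_mult[OF f])
    show "integrable lborel g"
      unfolding g_def
      by (intro Bochner_Integration.integrable_diff integrable_mult_right integrable_character_mult f f')
    show "((\<lambda>t. exp (- \<i> * of_real ((x + t *\<^sub>R e) \<bullet> \<xi>)) * f (x + t *\<^sub>R e)) has_vector_derivative g x) (at 0)" for x
    proof -
      have "((\<lambda>t. exp (- \<i> * of_real ((x + t *\<^sub>R e) \<bullet> \<xi>))) has_vector_derivative
          exp (- \<i> * of_real (x \<bullet> \<xi>)) * (- \<i> * of_real (e \<bullet> \<xi>))) (at 0)"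
      proof -
        \<comment> \<open>The character is differentiated in a complex parameter and then restricted
          to the real line.\<close>
        have "((\<lambda>z. exp (- \<i> * (of_real (x \<bullet> \<xi>) + z * of_real (e \<bullet> \<xi>)))) has_field_derivative
            exp (- \<i> * of_real (x \<bullet> \<xi>)) * (- \<i> * of_real (e \<bullet> \<xi>))) (at (of_real 0))"
          by (auto intro!: derivative_eq_intros)
        from has_vector_derivative_real_field[OF this, of UNIV] show ?thesis
          by (simp add: inner_add_left)
      qed
      from has_vector_derivative_mult[OF this deriv[of x]] show ?thesis
        by (simp add: g_def algebra_simps inner_commute)
    qed
  qed
  then show ?thesis
    using integrable_character_mult(1)[OF f] integrable_character_mult(1)[OF f']
    unfolding g_def ft_def by simp
qed

text \<open>If M is the maximum of 1 and all \<open>a j\<close>, the base on the left is at most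
  (CARD + 1) M, and M^N is 1 or one of the \<open>a j ^ N\<close>. Hence estimates with pure powers
  of single coordinates give estimates with powers of the norm.\<close>

lemma power_1_plus_sum_le:
  fixes a :: "'i::finite \<Rightarrow> real"
  assumes "\<And>j. a j \<ge> 0"
  shows "(1 + (\<Sum>j\<in>UNIV. a j)) ^ N \<le> (real CARD('i) + 1) ^ N * (1 + (\<Sum>j\<in>UNIV. a j ^ N))"
proof -
  define M where "M = Max (insert 1 (range a))"
  have M: "M \<ge> 1" "\<And>j. a j \<le> M" by (auto simp: M_def max.coboundedI2)
  have "M \<in> insert 1 (range a)" unfolding M_def by (rule Max_in) auto
  then have "M ^ N \<le> 1 + (\<Sum>j\<in>UNIV. a j ^ N)"
  proof
    assume "M \<in> range a"
    then obtain j where "M = a j" by blast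
    then show ?thesis
      using member_le_sum[of j UNIV "\<lambda>j. a j ^ N"] assms by simp
  qed (simp add: assms sum_nonneg)
  moreover have "(1 + (\<Sum>j\<in>UNIV. a j)) \<le> (real CARD('i) + 1) * M"
    using sum_bounded_above[of UNIV a M] M by (simp add: algebra_simps)
  then have "(1 + (\<Sum>j\<in>UNIV. a j)) ^ N \<le> ((real CARD('i) + 1) * M) ^ N"
    by (rule power_mono) (simp add: assms sum_nonneg add_nonneg_nonneg)
  ultimately show ?thesis
    by (auto simp: power_mult_distrib elim!: order.trans intro!: mult_left_mono)
qed

section \<open>Transforms of Schwartz functions\<close>

lemma schwartz_rapidly_decreasing:
  assumes "schwartz f"
  shows "rapidly_decreasing (partial_derivs js f)"
proof -
  have "continuous_on UNIV (partial_derivs js f)"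
    using assms unfolding schwartz_def
    by (auto intro!: differentiable_imp_continuous_on simp: differentiable_on_def)
  then show ?thesis
    using assms unfolding schwartz_def rapidly_decreasing_def
    by (auto intro!: borel_measurable_continuous_onI)
qed

lemma ft_partial_derivs:
  fixes f :: "real ^ 'n::finite \<Rightarrow> complex"
  assumes f: "schwartz f"
  shows "ft (partial_derivs (replicate N j) f) \<xi> = (\<i> * of_real (\<xi> $ j)) ^ N * ft f \<xi>"
proof (induction N)
  case (Suc N)
  let ?g = "partial_derivs (replicate N j) f"
  have "ft (partial_deriv j ?g) \<xi> = \<i> * of_real (\<xi> \<bullet> axis j 1) * ft ?g \<xi>"
  proof (rule ft_directional_derivative)
    show "integrable lborel ?g" "integrable lborel (partial_deriv j ?g)"
      using rapidly_decreasing_integrable[OF schwartz_rapidly_decreasing[OF f]]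
      by (auto simp flip: partial_derivs.simps(2))
    fix x
    have "(?g has_derivative frechet_derivative ?g (at x)) (at (x + 0 *\<^sub>R axis j 1))"
      using f unfolding schwartz_def by (simp add: frechet_derivative_works)
    moreover have "((\<lambda>t. x + t *\<^sub>R axis j 1) has_derivative (\<lambda>t. t *\<^sub>R axis j 1)) (at (0::real))"
      by (auto intro!: derivative_eq_intros)
    ultimately have "(?g \<circ> (\<lambda>t. x + t *\<^sub>R axis j 1) has_derivative
        frechet_derivative ?g (at x) \<circ> (\<lambda>t. t *\<^sub>R axis j 1)) (at (0::real))"
      by (intro diff_chain_at)
    moreover have "linear (frechet_derivative ?g (at x))"
      using f unfolding schwartz_def by (simp add: linear_frechet_derivative)
    ultimately show "((\<lambda>t. ?g (x + t *\<^sub>R axis j 1)) has_vector_derivative partial_deriv j ?g x) (at 0)"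
      by (simp add: has_vector_derivative_def partial_deriv_def o_def linear_scale)
  qed
  with Suc show ?case
    by (simp add: inner_axis)
qed simp

text \<open>\<open>power_1_plus_sum_le\<close> leaves the pure powers |\<xi>_j|^N |ft f \<xi>|. Each
  is the modulus of the transform of an N-th partial derivative, hence at most the L1 norm of that
  derivative.\<close>

lemma rapidly_decreasing_ft:
  fixes f :: "real ^ 'n::finite \<Rightarrow> complex"
  assumes f: "schwartz f"
  shows "rapidly_decreasing (ft f)"
  unfolding rapidly_decreasing_def
proof (intro conjI allI)
  have int: "integrable lborel (partial_derivs js f)" for js
    by (intro rapidly_decreasing_integrable schwartz_rapidly_decreasing f)
  show "ft f \<in> borel_measurable borel"
    using continuous_on_ft[OF int[of "[]"]] by (auto intro!: borel_measurable_continuous_onI)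
  fix N
  define D where "D j = (LINT x|lborel. cmod (partial_derivs (replicate N j) f x))" for j
  define D0 where "D0 = (LINT x|lborel. cmod (f x))"
  have "(1 + norm \<xi>) ^ N * cmod (ft f \<xi>) \<le> (real CARD('n) + 1) ^ N * (D0 + (\<Sum>j\<in>UNIV. D j))" for \<xi>
  proof -
    have "(1 + norm \<xi>) ^ N \<le> (1 + (\<Sum>j\<in>UNIV. \<bar>\<xi> $ j\<bar>)) ^ N"
      using norm_le_l1_cart[of \<xi>] by (intro power_mono) auto
    also have "\<dots> \<le> (real CARD('n) + 1) ^ N * (1 + (\<Sum>j\<in>UNIV. \<bar>\<xi> $ j\<bar> ^ N))"
      by (rule power_1_plus_sum_le) simp
    finally have "(1 + norm \<xi>) ^ N * cmod (ft f \<xi>)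
        \<le> (real CARD('n) + 1) ^ N * (1 + (\<Sum>j\<in>UNIV. \<bar>\<xi> $ j\<bar> ^ N)) * cmod (ft f \<xi>)"
      by (rule mult_right_mono) simp
    also have "\<dots> = (real CARD('n) + 1) ^ N * (cmod (ft f \<xi>) + (\<Sum>j\<in>UNIV. \<bar>\<xi> $ j\<bar> ^ N * cmod (ft f \<xi>)))"
      by (simp add: distrib_right sum_distrib_right mult.assoc)
    also have "\<dots> \<le> (real CARD('n) + 1) ^ N * (D0 + (\<Sum>j\<in>UNIV. D j))"
    proof (intro mult_left_mono add_mono sum_mono)
      show "cmod (ft f \<xi>) \<le> D0"
        unfolding D0_def using norm_ft_le[OF int[of "[]"]] by simp
      show "\<bar>\<xi> $ j\<bar> ^ N * cmod (ft f \<xi>) \<le> D j" for j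
        unfolding D_def using norm_ft_le[OF int[of "replicate N j"], of \<xi>]
        by (simp add: ft_partial_derivs[OF f] norm_mult norm_power)
    qed simp
    finally show ?thesis .
  qed
  then show "\<exists>C. \<forall>\<xi>. (1 + norm \<xi>) ^ N * cmod (ft f \<xi>) \<le> C"
    by blast
qed

section \<open>Fourier transforms supported in a ball\<close>

text \<open>The \<open>q\<close>-th derivative of \<open>ft f\<close> along \<open>e\<close>, given
  as the transform of a moment so that continuity and the bound near the boundary carry over from
  \<open>ft\<close>.\<close>

definition ft_deriv :: "'a::euclidean_space \<Rightarrow> nat \<Rightarrow> ('a \<Rightarrow> complex) \<Rightarrow> 'a \<Rightarrow> complex" where
  "ft_deriv e q f = ft (\<lambda>x. (- \<i> * of_real (x \<bullet> e)) ^ q * f x)"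

lemma ft_deriv_0 [simp]: "ft_deriv e 0 f = ft f"
  by (simp add: ft_deriv_def)

lemma has_vector_derivative_ft_deriv:
  assumes "rapidly_decreasing f"
  shows "((\<lambda>t. ft_deriv e q f (\<xi> + t *\<^sub>R e)) has_vector_derivative ft_deriv e (Suc q) f \<xi>) (at 0)"
  using has_vector_derivative_ft[OF rapidly_decreasing_moment[OF assms, of e q], of \<xi> e]
  by (simp add: ft_deriv_def mult.assoc)

lemma continuous_on_ft_deriv:
  "rapidly_decreasing f \<Longrightarrow> continuous_on UNIV (ft_deriv e q f)"
  unfolding ft_deriv_def
  by (intro continuous_on_ft rapidly_decreasing_integrable rapidly_decreasing_moment)

text \<open>The exterior of the ball is open, so along the line each derivative is that of a
  function vanishing near \<open>t = 0\<close>.\<close>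

lemma ft_deriv_vanishes:
  assumes f: "rapidly_decreasing f" and van: "\<And>\<xi>. norm \<xi> > R \<Longrightarrow> ft f \<xi> = 0"
    and "norm \<xi> > R"
  shows "ft_deriv e q f \<xi> = 0"
  using \<open>norm \<xi> > R\<close>
proof (induction q arbitrary: \<xi>)
  case (Suc q)
  have op: "open {t. R < norm (\<xi> + t *\<^sub>R e)}"
    by (intro open_Collect_less continuous_intros)
  have mem: "0 \<in> {t. R < norm (\<xi> + t *\<^sub>R e)}"
    using Suc.prems by simp
  have eq: "0 = ft_deriv e q f (\<xi> + t *\<^sub>R e)" if "t \<in> {t. R < norm (\<xi> + t *\<^sub>R e)}" for t
    using Suc.IH that by simp
  have "((\<lambda>t. ft_deriv e q f (\<xi> + t *\<^sub>R e)) has_vector_derivative 0) (at 0)"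
    by (rule has_vector_derivative_transform_within_open[OF has_vector_derivative_const op mem eq])
  from vector_derivative_unique_at[OF this has_vector_derivative_ft_deriv[OF f]] show ?case
    by simp
qed (simp add: van)

lemma cmod_exp_minus_1_le: "cmod (1 - exp (- \<i> * of_real y)) \<le> \<bar>y\<bar>"
  using iexp_approx1[of "- y" 0] by (simp add: norm_minus_commute)

text \<open>
  The \<open>N\<close>-th difference of \<open>ft f\<close> at \<open>\<xi>\<close> in the outward radial direction with step \<open>\<delta> > R - norm \<xi>\<close>
  consists of the single term \<open>ft f \<xi>\<close>. On the other side it multiplies \<open>f\<close> by
  \<open>(1 - e\<^bsup>-i\<delta>x\<bullet>u\<^esup>)\<^sup>N\<close>, which is at most \<open>(\<delta> \<bar>x\<bar>)\<^sup>N\<close>.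
\<close>

lemma ft_bound_near_boundary:
  fixes f :: "'a::euclidean_space \<Rightarrow> complex"
  assumes f: "rapidly_decreasing f" and van: "\<And>\<xi>. norm \<xi> > R \<Longrightarrow> ft f \<xi> = 0"
    and \<xi>: "norm \<xi> \<le> R"
  shows "cmod (ft f \<xi>) \<le> (R - norm \<xi>) ^ N * (LINT x|lborel. norm x ^ N * cmod (f x))"
proof -
  have int: "integrable lborel f"
    by (rule rapidly_decreasing_integrable[OF f])
  note [measurable] = rapidly_decreasing_measurable[OF f]
  have "integrable lborel (\<lambda>x. complex_of_real (norm x ^ N) * f x)"
    by (intro rapidly_decreasing_integrable rapidly_decreasing_mult[OF f, of _ 1 N])
      (auto simp: norm_power intro!: power_mono)
  from integrable_norm[OF this] have intN: "integrable lborel (\<lambda>x. norm x ^ N * cmod (f x))"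
    by (simp add: norm_mult norm_power)
  \<comment> \<open>A direction in which the norm grows at unit speed: the radial one, or any basis
    vector if \<xi> = 0.\<close>
  obtain u :: 'a where u: "norm u = 1" "\<And>c. c \<ge> 0 \<Longrightarrow> norm (\<xi> + c *\<^sub>R u) = norm \<xi> + c"
  proof (cases "\<xi> = 0")
    case True
    then show ?thesis
      using that[of "SOME b. b \<in> Basis"] SOME_Basis by (auto simp: norm_Basis)
  next
    case False
    have "norm (\<xi> + c *\<^sub>R (\<xi> /\<^sub>R norm \<xi>)) = norm \<xi> + c" if "c \<ge> 0" for c
    proof -
      have "\<xi> + c *\<^sub>R (\<xi> /\<^sub>R norm \<xi>) = (1 + c / norm \<xi>) *\<^sub>R \<xi>"
        by (simp add: scaleR_add_left divide_inverse)
      also have "norm \<dots> = (1 + c / norm \<xi>) * norm \<xi>"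
        using that by simp
      also have "\<dots> = norm \<xi> + c"
        using False by (simp add: distrib_right)
      finally show ?thesis .
    qed
    with False show ?thesis
      by (intro that[of "\<xi> /\<^sub>R norm \<xi>"]) auto
  qed
  have bound: "cmod (ft f \<xi>) \<le> \<delta> ^ N * (LINT x|lborel. norm x ^ N * cmod (f x))"
    if \<delta>: "\<delta> > R - norm \<xi>" for \<delta>
  proof -
    have \<delta>0: "\<delta> > 0" using \<delta> \<xi> by simp
    define g where "g k x = (1 - exp (- \<i> * of_real (x \<bullet> (\<delta> *\<^sub>R u)))) ^ k * f x" for k x
    have g_le: "cmod (g k x) \<le> (\<delta> * norm x) ^ k * cmod (f x)" for k x
    proof -
      have "cmod (1 - exp (- \<i> * of_real (x \<bullet> (\<delta> *\<^sub>R u)))) \<le> \<bar>x \<bullet> (\<delta> *\<^sub>R u)\<bar>"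
        by (rule cmod_exp_minus_1_le)
      also have "\<dots> \<le> \<delta> * norm x"
        using Cauchy_Schwarz_ineq2[of x "\<delta> *\<^sub>R u"] u \<delta>0 by (simp add: mult.commute)
      finally show ?thesis
        unfolding g_def norm_mult norm_power by (intro mult_right_mono power_mono) auto
    qed
    have g_int: "integrable lborel (g k)" for k
    proof (rule Bochner_Integration.integrable_bound[OF integrable_mult_right[OF int, of "2 ^ k"]])
      show "g k \<in> borel_measurable lborel"
        unfolding g_def by measurable
      have "cmod (1 - exp (- \<i> * of_real y)) \<le> 2" for y
        using norm_triangle_ineq4[of 1 "exp (- \<i> * of_real y)"] by simp
      then have "cmod (1 - exp (- \<i> * of_real y)) ^ k \<le> 2 ^ k" for y
        by (rule power_mono) simp
      then show "AE x in lborel. norm (g k x) \<le> norm (2 ^ k * f x)"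
        unfolding g_def norm_mult norm_power norm_numeral by (intro AE_I2 mult_right_mono norm_ge_zero)
    qed
    \<comment> \<open>Stated for all \<open>l\<close> so that the induction works: for l > 0 the
      points lie outside the ball, where \<open>ft f\<close> and all its differences vanish, so
      differencing never changes the value at l = 0.\<close>
    have "ft (g k) (\<xi> + (real l * \<delta>) *\<^sub>R u) = (if l = 0 then ft f \<xi> else 0)" for k l
    proof (induction k arbitrary: l)
      case 0
      have "R < norm (\<xi> + (real l * \<delta>) *\<^sub>R u)" if "l > 0"
      proof -
        have "\<delta> \<le> real l * \<delta>" using that \<delta>0 by simp
        then show ?thesis using \<delta> \<delta>0 by (subst u(2)) (simp, linarith)
      qed
      then show ?case
        by (auto simp: g_def van)
    next
      case (Suc k)
      let ?\<eta> = "\<xi> + (real l * \<delta>) *\<^sub>R u"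
      have "g (Suc k) = (\<lambda>x. g k x - exp (- \<i> * of_real (x \<bullet> (\<delta> *\<^sub>R u))) * g k x)"
        by (simp add: g_def fun_eq_iff algebra_simps)
      then have "ft (g (Suc k)) ?\<eta> = ft (g k) ?\<eta> - ft (g k) (?\<eta> + \<delta> *\<^sub>R u)"
        by (simp only: ft_shift[of _ ?\<eta>]) (intro ft_diff g_int integrable_character_mult)
      also have "?\<eta> + \<delta> *\<^sub>R u = \<xi> + (real (Suc l) * \<delta>) *\<^sub>R u"
        by (simp add: algebra_simps)
      finally show ?case
        by (simp only: Suc) simp
    qed
    from this[of N 0] have "cmod (ft f \<xi>) = cmod (ft (g N) \<xi>)"
      by simp
    also have "\<dots> \<le> (LINT x|lborel. cmod (g N x))"
      by (rule norm_ft_le[OF g_int])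
    also have "\<dots> \<le> (LINT x|lborel. \<delta> ^ N * (norm x ^ N * cmod (f x)))"
      using g_le[of N] intN g_int[of N]
      by (intro integral_mono) (auto simp: power_mult_distrib mult.assoc)
    finally show ?thesis by simp
  qed
  \<comment> \<open>Vanishing is assumed only strictly outside the ball, so the bound for the step R
    - |\<xi>| itself is a limit from the right.\<close>
  have "((\<lambda>\<delta>. \<delta> ^ N * (LINT x|lborel. norm x ^ N * cmod (f x)))
      \<longlongrightarrow> (R - norm \<xi>) ^ N * (LINT x|lborel. norm x ^ N * cmod (f x))) (at_right (R - norm \<xi>))"
    by (intro tendsto_intros)
  then show ?thesis
    by (rule tendsto_lowerbound) (auto simp: eventually_at_filter bound)
qed

section \<open>Weight estimates uniform in the exponent\<close>

lemma power_le_fact_exp: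
  fixes y :: real
  assumes "y \<ge> 0"
  shows "y ^ i \<le> fact i * exp y"
proof -
  have "y ^ i / fact i \<le> (\<Sum>k\<le>i. y ^ k /\<^sub>R fact k)"
    using assms member_le_sum[of i "{..i}" "\<lambda>k. y ^ k /\<^sub>R fact k"] by (simp add: field_simps)
  also have "\<dots> \<le> exp y"
    unfolding sums_unique[OF exp_converges[of y]]
    by (rule sum_le_suminf[OF sums_summable[OF exp_converges]]) (use assms in auto)
  finally show ?thesis
    by (simp add: field_simps)
qed

text \<open>Put t = r / R and y = Q (1 - t) + L. Then K (1 - t) <= y and y^i <= i! e^y, while ln t
  <= t - 1 gives t^Q <= e^(-Q (1 - t)). The exponentials cancel up to e^L, so the constant depends
  on neither Q nor K.\<close>

lemma weight_bound:
  fixes r R Q K L d :: real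
  assumes r: "0 < r" "r \<le> R" and Q: "0 \<le> Q" and K: "0 \<le> K" "K \<le> Q + L" and L: "0 \<le> L"
  shows "K ^ i * (r powr (Q - d) * (R - r) ^ i) \<le> fact i * exp L * R powr (Q + real i) * r powr - d"
proof -
  define t where "t = r / R"
  have R: "R > 0" using r by simp
  have t: "0 < t" "t \<le> 1" and rt: "r = R * t" using r R by (auto simp: t_def)
  have "K * (1 - t) \<le> Q * (1 - t) + L"
  proof -
    have "K * (1 - t) \<le> (Q + L) * (1 - t)"
      using K t by (intro mult_right_mono) auto
    moreover have "L * (1 - t) \<le> L"
      using L t by (intro mult_left_le) auto
    ultimately show ?thesis
      unfolding distrib_right by linarith
  qed
  then have "(K * (1 - t)) ^ i \<le> (Q * (1 - t) + L) ^ i"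
    using K t by (intro power_mono) auto
  also have "\<dots> \<le> fact i * exp (Q * (1 - t) + L)"
    using Q t L by (intro power_le_fact_exp) auto
  finally have "(K * (1 - t)) ^ i * t powr Q \<le> fact i * exp (Q * (1 - t) + L) * t powr Q"
    by (rule mult_right_mono) simp
  also have "t powr Q \<le> exp (- (Q * (1 - t)))"
    using t ln_le_minus_one[OF t(1)] Q mult_left_mono[of "ln t" "t - 1" Q]
    by (simp add: powr_def algebra_simps)
  then have "fact i * exp (Q * (1 - t) + L) * t powr Q
      \<le> fact i * exp (Q * (1 - t) + L) * exp (- (Q * (1 - t)))"
    by (intro mult_left_mono) auto
  also have "\<dots> = fact i * exp L"
    by (simp add: mult.assoc flip: exp_add)
  finally have main: "(K * (1 - t)) ^ i * t powr Q \<le> fact i * exp L" .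
  have "K ^ i * (r powr (Q - d) * (R - r) ^ i)
      = ((K * (1 - t)) ^ i * t powr Q) * (R powr (Q + real i) * r powr - d)"
  proof -
    have "(R - r) ^ i = R powr real i * (1 - t) ^ i"
    proof -
      have "R - r = R * (1 - t)"
        by (simp add: rt right_diff_distrib)
      then show ?thesis
        using R by (simp add: powr_realpow power_mult_distrib)
    qed
    moreover have "r powr (Q - d) = R powr Q * t powr Q * r powr - d"
    proof -
      have "r powr (Q - d) = r powr Q * r powr - d"
        by (simp flip: powr_add)
      also have "r powr Q = R powr Q * t powr Q"
        using R t by (simp add: rt powr_mult)
      finally show ?thesis .
    qed
    ultimately show ?thesis
      by (simp add: power_mult_distrib powr_add mult_ac)
  qed
  also have "\<dots> \<le> (fact i * exp L) * (R powr (Q + real i) * r powr - d)"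
    by (rule mult_right_mono[OF main]) auto
  finally show ?thesis by (simp add: mult_ac)
qed

lemma integrable_continuous_compact_support:
  fixes f :: "'a::euclidean_space \<Rightarrow> 'b::{banach,second_countable_topology}"
  assumes "continuous_on UNIV f" "\<And>x. norm x > R \<Longrightarrow> f x = 0"
  shows "integrable lborel f"
proof -
  have "integrable lborel (\<lambda>x. indicator (cball 0 R) x *\<^sub>R f x)"
    using assms by (intro borel_integrable_compact) (auto intro: continuous_on_subset)
  also have "(\<lambda>x. indicator (cball 0 R) x *\<^sub>R f x) = f"
    using assms(2) by (auto simp: fun_eq_iff indicator_def)
  finally show ?thesis .
qed

section \<open>Decay of multipliers\<close>

text \<open>\<open>ft_bound_near_boundary\<close> of order \<open>i\<close> supplies (R -
  |\<xi>|)^i, which \<open>weight_bound\<close> with d = n - 1 trades for the \<open>i\<close>-th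
  power of s + 3 M + 1. The constant \<open>D\<close> does not depend on \<open>s\<close>, and the
  remaining weight is integrable.\<close>

lemma weighted_ft_deriv_bound:
  fixes f :: "'a::euclidean_space \<Rightarrow> complex" and M :: nat
  assumes f: "rapidly_decreasing f" and van: "\<And>\<xi>. norm \<xi> > R \<Longrightarrow> ft f \<xi> = 0"
  obtains D where "D \<ge> 0"
    "\<And>s i q \<xi>. 0 \<le> s \<Longrightarrow> s > real M + 1 - real DIM('a) \<Longrightarrow> i \<le> M \<Longrightarrow> q \<le> M \<Longrightarrow>
      (s + 3 * real M + 1) ^ i * (norm \<xi> powr (s - real i) * cmod (ft_deriv e q f \<xi>))
        \<le> D * R powr s * (indicator (cball 0 R) \<xi> * norm \<xi> powr (1 - real DIM('a)))"
proof
  let ?n = "real DIM('a)"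
  define C where "C i q = (LINT x|lborel. norm x ^ i * cmod ((- \<i> * of_real (x \<bullet> e)) ^ q * f x))" for i q
  define D where "D = (\<Sum>i\<le>M. \<Sum>q\<le>M. C i q * (fact i * exp (4 * real M + 2) * R powr (?n - 1)))"
  have C: "C i q \<ge> 0" for i q
    unfolding C_def by (intro integral_nonneg_AE) auto
  then show "D \<ge> 0"
    unfolding D_def by (intro sum_nonneg mult_nonneg_nonneg) auto
  fix s i q \<xi> assume s: "0 \<le> s" "s > real M + 1 - ?n" and i: "i \<le> M" and q: "q \<le> M"
  let ?K = "s + 3 * real M + 1"
  show "?K ^ i * (norm \<xi> powr (s - real i) * cmod (ft_deriv e q f \<xi>))
        \<le> D * R powr s * (indicator (cball 0 R) \<xi> * norm \<xi> powr (1 - ?n))"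
  \<comment> \<open>At the origin both sides are 0 because \<open>0 powr b = 0\<close> for every
    exponent; outside the ball the derivative vanishes.\<close>
  proof (cases "\<xi> = 0 \<or> norm \<xi> > R")
    case True
    then show ?thesis
      using ft_deriv_vanishes[OF f van] by auto
  next
    case False
    then have r: "0 < norm \<xi>" "norm \<xi> \<le> R" by auto
    \<comment> \<open>The lower bound on \<open>s\<close> makes \<open>Q\<close> nonnegative for
      every i <= M. The gap between s + 3 M + 1 and \<open>Q\<close> is at most 4 M + 2, the value
      used for L.\<close>
    define Q where "Q = s - real i + ?n - 1"
    have Q: "Q \<ge> 0" "?K \<le> Q + (4 * real M + 2)"
      using s i by (simp_all add: Q_def)
    have "cmod (ft_deriv e q f \<xi>) \<le> (R - norm \<xi>) ^ i * C i q"
      unfolding ft_deriv_def C_def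
      by (rule ft_bound_near_boundary[OF rapidly_decreasing_moment[OF f]])
        (use ft_deriv_vanishes[OF f van] r in \<open>auto simp: ft_deriv_def\<close>)
    then have "?K ^ i * (norm \<xi> powr (s - real i) * cmod (ft_deriv e q f \<xi>))
        \<le> ?K ^ i * (norm \<xi> powr (s - real i) * ((R - norm \<xi>) ^ i * C i q))"
      using s by (intro mult_left_mono) auto
    also have "\<dots> = C i q * (?K ^ i * (norm \<xi> powr (Q - (?n - 1)) * (R - norm \<xi>) ^ i))"
      by (simp add: Q_def algebra_simps)
    also have "\<dots> \<le> C i q * (fact i * exp (4 * real M + 2) * R powr (Q + real i) * norm \<xi> powr - (?n - 1))"
      using s by (intro mult_left_mono C weight_bound[OF r Q(1) _ Q(2)]) auto
    also have "\<dots> = C i q * (fact i * exp (4 * real M + 2) * R powr (?n - 1)) * (R powr s * norm \<xi> powr (1 - ?n))"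
    proof -
      have "R powr (Q + real i) = R powr (?n - 1) * R powr s"
        unfolding Q_def by (simp add: algebra_simps flip: powr_add)
      then show ?thesis by simp
    qed
    also have "\<dots> \<le> D * (R powr s * norm \<xi> powr (1 - ?n))"
    proof (rule mult_right_mono)
      have "C i q * (fact i * exp (4 * real M + 2) * R powr (?n - 1))
          \<le> (\<Sum>q\<le>M. C i q * (fact i * exp (4 * real M + 2) * R powr (?n - 1)))"
        using q C by (intro member_le_sum) auto
      also have "\<dots> \<le> D"
        unfolding D_def using i C
        by (intro member_le_sum[of i _ "\<lambda>i. \<Sum>q\<le>M. C i q * (fact i * exp (4 * real M + 2) * R powr (?n - 1))"])
          (auto intro!: sum_nonneg)
      finally show "C i q * (fact i * exp (4 * real M + 2) * R powr (?n - 1)) \<le> D" .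
    qed simp
    finally show ?thesis
      using r by (simp add: mult.assoc)
  qed
qed

section \<open>Regularized oscillatory integrals\<close>

text \<open>With p = q = 0 and a = s / 2 this approximates the integral with symbol |\<xi>|^s as
  \<delta> tends to 0. The indices \<open>p\<close> and \<open>a\<close> record the terms that arise
  when the weight is differentiated along \<open>e\<close>, and \<open>q\<close> counts the
  derivatives that fall on \<open>ft f\<close>.\<close>

definition regularized_integral ::
    "'a::euclidean_space \<Rightarrow> ('a \<Rightarrow> complex) \<Rightarrow> 'a \<Rightarrow> real \<Rightarrow> nat \<Rightarrow> real \<Rightarrow> nat \<Rightarrow> complex" where
  "regularized_integral e f x \<delta> p a q =
     (LINT \<xi>|lborel. exp (\<i> * of_real (x \<bullet> \<xi>)) *
        (of_real ((\<xi> \<bullet> e) ^ p * (\<delta> + (norm \<xi>)\<^sup>2) powr a) * ft_deriv e q f \<xi>))"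

lemma regularized_integrable:
  fixes f :: "'a::euclidean_space \<Rightarrow> complex"
  assumes f: "rapidly_decreasing f" and van: "\<And>\<xi>. norm \<xi> > R \<Longrightarrow> ft f \<xi> = 0" and \<delta>: "\<delta> > 0"
  shows "integrable lborel (\<lambda>\<xi>. exp (\<i> * of_real (x \<bullet> \<xi>)) *
        (of_real ((\<xi> \<bullet> e) ^ p * (\<delta> + (norm \<xi>)\<^sup>2) powr a) * ft_deriv e q f \<xi>))"
    and "integrable lborel (\<lambda>\<xi>. (\<delta> + (norm \<xi>)\<^sup>2) powr a * cmod (ft_deriv e q f \<xi>))"
proof -
  have pos: "\<delta> + (norm \<xi>)\<^sup>2 \<noteq> 0" for \<xi> :: 'a
    using \<delta> by (metis add_pos_nonneg less_irrefl zero_le_power2)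
  note F = continuous_on_compose2[OF continuous_on_ft_deriv[OF f] continuous_on_id subset_UNIV]
  show "integrable lborel (\<lambda>\<xi>. exp (\<i> * of_real (x \<bullet> \<xi>)) *
        (of_real ((\<xi> \<bullet> e) ^ p * (\<delta> + (norm \<xi>)\<^sup>2) powr a) * ft_deriv e q f \<xi>))"
    "integrable lborel (\<lambda>\<xi>. (\<delta> + (norm \<xi>)\<^sup>2) powr a * cmod (ft_deriv e q f \<xi>))"
    by (rule integrable_continuous_compact_support[where R = R],
        intro continuous_intros F, use pos ft_deriv_vanishes[OF f van] in auto)+
qed

text \<open>The four terms are the product rule for the character, the power of \<xi>.e, the weight
  and the derivative of \<open>ft f\<close>. For p = 0 the truncated \<open>p - 1\<close> is
  harmless because its coefficient is 0.\<close>

lemma regularized_integral_by_parts: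
  fixes f :: "'a::euclidean_space \<Rightarrow> complex"
  assumes f: "rapidly_decreasing f" and van: "\<And>\<xi>. norm \<xi> > R \<Longrightarrow> ft f \<xi> = 0" and \<delta>: "\<delta> > 0"
    and e: "norm e = 1"
  shows "\<i> * of_real (x \<bullet> e) * regularized_integral e f x \<delta> p a q
      + of_nat p * regularized_integral e f x \<delta> (p - 1) a q
      + of_real (2 * a) * regularized_integral e f x \<delta> (p + 1) (a - 1) q
      + regularized_integral e f x \<delta> p a (Suc q) = 0"
proof -
  define G where "G p a q \<xi> = exp (\<i> * of_real (x \<bullet> \<xi>)) *
        (of_real ((\<xi> \<bullet> e) ^ p * (\<delta> + (norm \<xi>)\<^sup>2) powr a) * ft_deriv e q f \<xi>)" for p a q and \<xi> :: 'a
  have G: "integrable lborel (G p a q)" for p a q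
    unfolding G_def by (rule regularized_integrable(1)[OF f van \<delta>])
  define G' where "G' \<xi> = \<i> * of_real (x \<bullet> e) * G p a q \<xi> + of_nat p * G (p - 1) a q \<xi>
      + of_real (2 * a) * G (p + 1) (a - 1) q \<xi> + G p a (Suc q) \<xi>" for \<xi> :: 'a
  have "(LINT \<xi>|lborel. G' \<xi>) = 0"
  proof (rule integral_directional_derivative_eq_0)
    show "integrable lborel (G p a q)" "integrable lborel G'"
      unfolding G'_def using G by auto
    fix \<xi> :: 'a
    have pos: "\<delta> + (norm \<xi>)\<^sup>2 > 0"
      using \<delta> by (simp add: add_pos_nonneg)
    have 1: "((\<lambda>t. exp (\<i> * of_real (x \<bullet> (\<xi> + t *\<^sub>R e)))) has_vector_derivative
        exp (\<i> * of_real (x \<bullet> \<xi>)) * (\<i> * of_real (x \<bullet> e))) (at 0)"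
    proof -
      have "((\<lambda>z. exp (\<i> * (of_real (x \<bullet> \<xi>) + z * of_real (x \<bullet> e)))) has_field_derivative
          exp (\<i> * of_real (x \<bullet> \<xi>)) * (\<i> * of_real (x \<bullet> e))) (at (of_real 0))"
        by (auto intro!: derivative_eq_intros)
      from has_vector_derivative_real_field[OF this, of UNIV] show ?thesis
        by (simp add: inner_add_right)
    qed
    \<comment> \<open>Since \<open>e\<close> is a unit vector, the regularized squared norm is a
      quadratic polynomial in \<open>t\<close> along the line.\<close>
    define w where "w t = \<delta> + ((norm \<xi>)\<^sup>2 + 2 * t * (\<xi> \<bullet> e) + t\<^sup>2)" for t
    have w: "\<delta> + (norm (\<xi> + t *\<^sub>R e))\<^sup>2 = w t" for t
      using e by (simp add: w_def power2_norm_eq_inner inner_add_left inner_add_right inner_commute norm_eq_1 power2_eq_square[of t])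
    have w': "(w has_field_derivative 2 * (\<xi> \<bullet> e)) (at 0)"
      unfolding w_def by (auto intro!: derivative_eq_intros)
    have w0: "w 0 = \<delta> + (norm \<xi>)\<^sup>2"
      by (simp add: w_def)
    have "((\<lambda>t. (\<xi> \<bullet> e + t) ^ p * w t powr a) has_real_derivative
        (real p * (\<xi> \<bullet> e) ^ (p - 1) * w 0 powr a + 2 * a * ((\<xi> \<bullet> e) ^ (p + 1) * w 0 powr (a - 1)))) (at 0)"
      using pos w0 by (auto intro!: derivative_eq_intros w' simp: algebra_simps)
    then have "((\<lambda>t. complex_of_real ((\<xi> \<bullet> e + t) ^ p * w t powr a)) has_vector_derivative
        of_real (real p * (\<xi> \<bullet> e) ^ (p - 1) * w 0 powr a + 2 * a * ((\<xi> \<bullet> e) ^ (p + 1) * w 0 powr (a - 1)))) (at 0)"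
      by (rule has_vector_derivative_of_real)
    moreover have "(\<xi> + t *\<^sub>R e) \<bullet> e = \<xi> \<bullet> e + t" for t
      using e by (simp add: inner_add_left norm_eq_1)
    ultimately have 2: "((\<lambda>t. complex_of_real (((\<xi> + t *\<^sub>R e) \<bullet> e) ^ p * (\<delta> + (norm (\<xi> + t *\<^sub>R e))\<^sup>2) powr a))
        has_vector_derivative of_real (real p * (\<xi> \<bullet> e) ^ (p - 1) * (\<delta> + (norm \<xi>)\<^sup>2) powr a
          + 2 * a * ((\<xi> \<bullet> e) ^ (p + 1) * (\<delta> + (norm \<xi>)\<^sup>2) powr (a - 1)))) (at 0)"
      by (simp add: w w0)
    show "((\<lambda>t. G p a q (\<xi> + t *\<^sub>R e)) has_vector_derivative G' \<xi>) (at 0)"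
      unfolding G_def
      using has_vector_derivative_mult[OF 1 has_vector_derivative_mult[OF 2
            has_vector_derivative_ft_deriv[OF f, where q = q and \<xi> = \<xi> and e = e]]]
      by (rule has_vector_derivative_eq_rhs) (simp add: G'_def G_def algebra_simps)
  qed
  moreover have "regularized_integral e f x \<delta> p a q = (LINT \<xi>|lborel. G p a q \<xi>)" for p a q
    by (simp only: regularized_integral_def G_def)
  ultimately show ?thesis
    using G unfolding G'_def by simp
qed

text \<open>Each integration by parts gains one factor x.e. A derivative on the power or the weight
  lowers the degree p + 2 a by one, raises \<open>i\<close>, and costs p or 2 |a|; these costs sum
  to at most \<open>K\<close>, which the extra factor \<open>K\<close> in the induction hypothesis
  repays. A derivative on \<open>ft f\<close> raises \<open>q\<close>. So each step at most doubles
  the bound. The term 3 j allows for p + 2 |a| growing by at most 3 per step.\<close>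

lemma regularized_integral_decay:
  fixes f :: "'a::euclidean_space \<Rightarrow> complex"
  assumes f: "rapidly_decreasing f" and van: "\<And>\<xi>. norm \<xi> > R \<Longrightarrow> ft f \<xi> = 0" and \<delta>: "\<delta> > 0"
    and e: "norm e = 1" and K: "K > 0"
    and B: "\<And>i q. i \<le> M \<Longrightarrow> q \<le> M \<Longrightarrow>
      K ^ i * (LINT \<xi>|lborel. (\<delta> + (norm \<xi>)\<^sup>2) powr ((s - real i) / 2) * cmod (ft_deriv e q f \<xi>)) \<le> B"
    and "i + j \<le> M" "q + j \<le> M" "real p + 2 * a = s - real i" "real p + 2 * \<bar>a\<bar> + 3 * real j \<le> K"
  shows "K ^ i * \<bar>x \<bullet> e\<bar> ^ j * cmod (regularized_integral e f x \<delta> p a q) \<le> 2 ^ j * B"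
  using assms(7-)
proof (induction j arbitrary: i p a q)
  case 0
  have "cmod (regularized_integral e f x \<delta> p a q)
      \<le> (LINT \<xi>|lborel. cmod (exp (\<i> * of_real (x \<bullet> \<xi>)) *
        (of_real ((\<xi> \<bullet> e) ^ p * (\<delta> + (norm \<xi>)\<^sup>2) powr a) * ft_deriv e q f \<xi>)))"
    unfolding regularized_integral_def by (rule integral_norm_bound)
  also have "\<dots> \<le> (LINT \<xi>|lborel. (\<delta> + (norm \<xi>)\<^sup>2) powr ((s - real i) / 2) * cmod (ft_deriv e q f \<xi>))"
  proof (rule integral_mono)
    fix \<xi> :: 'a
    let ?w = "\<delta> + (norm \<xi>)\<^sup>2"
    have w: "?w > 0"
      using \<delta> by (simp add: add_pos_nonneg)
    have "\<bar>\<xi> \<bullet> e\<bar> \<le> norm \<xi>"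
      using Cauchy_Schwarz_ineq2[of \<xi> e] e by simp
    also have "norm \<xi> \<le> ?w powr (1/2)"
      unfolding powr_half_sqrt[OF less_imp_le[OF w]] using \<delta> by (intro real_le_rsqrt) simp
    finally have "\<bar>\<xi> \<bullet> e\<bar> ^ p \<le> (?w powr (1/2)) ^ p"
      by (rule power_mono) simp
    also have "\<dots> = ?w powr (real p / 2)"
      using w by (simp add: powr_powr flip: powr_realpow)
    finally have "\<bar>\<xi> \<bullet> e\<bar> ^ p * ?w powr a \<le> ?w powr (real p / 2) * ?w powr a"
      by (rule mult_right_mono) simp
    also have "\<dots> = ?w powr ((s - real i) / 2)"
    proof -
      have "(s - real i) / 2 = real p / 2 + a"
        using 0(3) by simp
      then show ?thesis by (simp only: powr_add)
    qed
    finally have "\<bar>\<xi> \<bullet> e\<bar> ^ p * ?w powr a * cmod (ft_deriv e q f \<xi>)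
        \<le> ?w powr ((s - real i) / 2) * cmod (ft_deriv e q f \<xi>)"
      by (rule mult_right_mono) simp
    then show "cmod (exp (\<i> * of_real (x \<bullet> \<xi>)) * (of_real ((\<xi> \<bullet> e) ^ p * ?w powr a) * ft_deriv e q f \<xi>))
        \<le> ?w powr ((s - real i) / 2) * cmod (ft_deriv e q f \<xi>)"
      by (simp add: norm_mult norm_power)
  qed (use regularized_integrable[OF f van \<delta>] in \<open>auto intro: integrable_norm\<close>)
  finally have "K ^ i * cmod (regularized_integral e f x \<delta> p a q)
      \<le> K ^ i * (LINT \<xi>|lborel. (\<delta> + (norm \<xi>)\<^sup>2) powr ((s - real i) / 2) * cmod (ft_deriv e q f \<xi>))"
    using K by (intro mult_left_mono) auto
  also have "\<dots> \<le> B"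
    using 0 by (intro B) auto
  finally show ?case by simp
next
  case (Suc j)
  define I where "I = regularized_integral e f x \<delta>"
  define y where "y = \<bar>x \<bullet> e\<bar>"
  have y: "y \<ge> 0" by (simp add: y_def)
  let ?c = "2 ^ j * B"
  have K_nonneg: "K ^ i \<ge> 0" using K by simp
  have a1: "\<bar>a - 1\<bar> \<le> \<bar>a\<bar> + 1" by simp
  have "y * cmod (I p a q) = cmod (\<i> * of_real (x \<bullet> e) * I p a q)"
    by (simp add: norm_mult y_def)
  also have "\<i> * of_real (x \<bullet> e) * I p a q =
      - (of_nat p * I (p - 1) a q + of_real (2 * a) * I (p + 1) (a - 1) q + I p a (Suc q))"
    using regularized_integral_by_parts[OF f van \<delta> e, where x = x and p = p and a = a and q = q] unfolding I_def
    by (simp only: eq_neg_iff_add_eq_0 add.assoc)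
  also have "cmod \<dots> \<le> real p * cmod (I (p - 1) a q) + 2 * \<bar>a\<bar> * cmod (I (p + 1) (a - 1) q) + cmod (I p a (Suc q))"
    unfolding norm_minus_cancel
    by (intro order.trans[OF norm_triangle_ineq] add_mono) (auto simp: norm_mult)
  finally have "K ^ i * y ^ j * (y * cmod (I p a q)) \<le> K ^ i * y ^ j *
      (real p * cmod (I (p - 1) a q) + 2 * \<bar>a\<bar> * cmod (I (p + 1) (a - 1) q) + cmod (I p a (Suc q)))"
    using K_nonneg y by (intro mult_left_mono) auto
  also have "\<dots> = real p * (K ^ i * y ^ j * cmod (I (p - 1) a q))
      + 2 * \<bar>a\<bar> * (K ^ i * y ^ j * cmod (I (p + 1) (a - 1) q)) + K ^ i * y ^ j * cmod (I p a (Suc q))"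
    by (simp add: algebra_simps)
  also have "\<dots> \<le> real p * (?c / K) + 2 * \<bar>a\<bar> * (?c / K) + ?c"
  proof (intro add_mono)
    show "real p * (K ^ i * y ^ j * cmod (I (p - 1) a q)) \<le> real p * (?c / K)"
    \<comment> \<open>For p = 0 the truncated \<open>p - 1\<close> breaks the degree condition of
      the induction hypothesis, but the term has the factor 0.\<close>
    proof (cases "p = 0")
      case False
      have "K ^ Suc i * y ^ j * cmod (I (p - 1) a q) \<le> ?c"
        unfolding I_def y_def using Suc.prems False a1 by (intro Suc.IH) (auto simp: of_nat_diff)
      then show ?thesis
        using K by (intro mult_left_mono) (auto simp: field_simps)
    qed simp
    have "K ^ Suc i * y ^ j * cmod (I (p + 1) (a - 1) q) \<le> ?c"
      unfolding I_def y_def using Suc.prems a1 by (intro Suc.IH) auto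
    then show "2 * \<bar>a\<bar> * (K ^ i * y ^ j * cmod (I (p + 1) (a - 1) q)) \<le> 2 * \<bar>a\<bar> * (?c / K)"
      using K by (intro mult_left_mono) (auto simp: field_simps)
    show "K ^ i * y ^ j * cmod (I p a (Suc q)) \<le> ?c"
      unfolding I_def y_def using Suc.prems by (intro Suc.IH) auto
  qed
  also have "\<dots> = (real p + 2 * \<bar>a\<bar>) / K * ?c + ?c"
    by (simp add: add_divide_distrib algebra_simps)
  also have "\<dots> \<le> 1 * ?c + ?c"
  proof (rule add_right_mono, rule mult_right_mono)
    show "(real p + 2 * \<bar>a\<bar>) / K \<le> 1"
      using Suc.prems K by simp
    \<comment> \<open>\<open>B\<close> is nonnegative because it bounds the nonnegative integral for
      i = q = 0.\<close>
    have "0 \<le> K ^ 0 * (LINT \<xi>|lborel. (\<delta> + (norm \<xi>)\<^sup>2) powr ((s - real 0) / 2) * cmod (ft_deriv e 0 f \<xi>))"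
      by (auto intro!: integral_nonneg_AE)
    also have "\<dots> \<le> B" by (rule B) auto
    finally show "0 \<le> ?c" by simp
  qed
  finally show ?case
    by (simp add: I_def y_def mult_ac)
qed

text \<open>The limit \<delta> to 0 is taken before \<open>weighted_ft_deriv_bound\<close> is
  applied: for positive \<delta> the weight can exceed |\<xi>|^s, and the exact factor R^s would be
  lost.\<close>

lemma multiplier_decay:
  fixes f :: "'a::euclidean_space \<Rightarrow> complex" and M :: nat
  assumes f: "rapidly_decreasing f" and van: "\<And>\<xi>. norm \<xi> > R \<Longrightarrow> ft f \<xi> = 0"
    and e: "norm e = 1"
  obtains C where "C \<ge> 0"
    "\<And>s x. 0 \<le> s \<Longrightarrow> s > real M + 1 - real DIM('a) \<Longrightarrow>
      \<bar>x \<bullet> e\<bar> ^ M * cmod (LINT \<xi>|lborel. exp (\<i> * of_real (x \<bullet> \<xi>)) * (of_real (norm \<xi> powr s) * ft f \<xi>))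
        \<le> C * R powr s"
proof -
  let ?n = "real DIM('a)"
  obtain D where D: "D \<ge> 0"
    "\<And>s i q \<xi>. 0 \<le> s \<Longrightarrow> s > real M + 1 - ?n \<Longrightarrow> i \<le> M \<Longrightarrow> q \<le> M \<Longrightarrow>
      (s + 3 * real M + 1) ^ i * (norm \<xi> powr (s - real i) * cmod (ft_deriv e q f \<xi>))
        \<le> D * R powr s * (indicator (cball 0 R) \<xi> * norm \<xi> powr (1 - ?n))"
    using weighted_ft_deriv_bound[OF f van] by blast
  define V where "V = (LINT \<xi>::'a|lborel. indicator (cball 0 R) \<xi> * norm \<xi> powr (1 - ?n))"
  have V: "V \<ge> 0"
    unfolding V_def by (intro integral_nonneg_AE) auto
  have [measurable]: "ft_deriv e q f \<in> borel_measurable borel" for q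
    by (intro borel_measurable_continuous_onI continuous_on_ft_deriv f)
  show thesis
  proof
    \<comment> \<open>2^M comes from M integrations by parts, (M + 1)^2 from the number of pairs (i,
      q).\<close>
    show "2 ^ M * ((real M + 1)\<^sup>2 * (D * V)) \<ge> 0"
      using D V by simp
    fix s and x :: 'a assume s: "0 \<le> s" "s > real M + 1 - ?n"
    \<comment> \<open>The value of p + 2 |a| + 3 j at the start, where p = 0, a = s / 2 and j = M,
      is s + 3 M; the extra 1 keeps \<open>K\<close> positive when s = M = 0.\<close>
    define K where "K = s + 3 * real M + 1"
    have K: "K > 0" using s by (simp add: K_def)
    define w where "w n \<xi> = 1 / (real n + 1) + (norm \<xi>)\<^sup>2" for n :: nat and \<xi> :: 'a
    define J where "J n i q = (LINT \<xi>|lborel. w n \<xi> powr ((s - real i) / 2) * cmod (ft_deriv e q f \<xi>))" for n i q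
    define J' where "J' i q = (LINT \<xi>|lborel. norm \<xi> powr (s - real i) * cmod (ft_deriv e q f \<xi>))" for i q
    have w_le: "w n \<xi> \<le> 1 + R\<^sup>2" if "norm \<xi> \<le> R" for n \<xi>
      unfolding w_def using that by (intro add_mono power_mono) auto
    have w_pos: "w n \<xi> > 0" for n \<xi>
      unfolding w_def by (intro add_pos_nonneg) auto
    have w_lim: "(\<lambda>n. w n \<xi> powr (b / 2)) \<longlonglongrightarrow> norm \<xi> powr b" if "\<xi> \<noteq> 0" for b \<xi>
    proof -
      have "(\<lambda>n. 1 / (real n + 1)) \<longlonglongrightarrow> 0"
        using LIMSEQ_inverse_real_of_nat by (simp add: inverse_eq_divide add.commute)
      then have "(\<lambda>n. w n \<xi>) \<longlonglongrightarrow> 0 + (norm \<xi>)\<^sup>2"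
        unfolding w_def by (intro tendsto_intros)
      then have "(\<lambda>n. w n \<xi> powr (b / 2)) \<longlonglongrightarrow> (0 + (norm \<xi>)\<^sup>2) powr (b / 2)"
        using that by (intro tendsto_powr) auto
      then show ?thesis
        using that by (simp add: powr_powr flip: powr_numeral)
    qed
    have int': "integrable lborel (\<lambda>\<xi>. norm \<xi> powr (s - real i) * cmod (ft_deriv e q f \<xi>))"
      and J'_le: "K ^ i * J' i q \<le> D * R powr s * V" if "i \<le> M" "q \<le> M" for i q
    proof -
      have V_int: "integrable lborel (\<lambda>\<xi>::'a. D * R powr s * (indicator (cball 0 R) \<xi> * norm \<xi> powr (1 - ?n)))"
        by (intro integrable_mult_right integrable_norm_powr_cball)
      have le: "K ^ i * (norm \<xi> powr (s - real i) * cmod (ft_deriv e q f \<xi>))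
        \<le> D * R powr s * (indicator (cball 0 R) \<xi> * norm \<xi> powr (1 - ?n))" for \<xi>
        unfolding K_def by (rule D(2)) (use s that in auto)
      have "integrable lborel (\<lambda>\<xi>. K ^ i * (norm \<xi> powr (s - real i) * cmod (ft_deriv e q f \<xi>)))"
      proof (rule Bochner_Integration.integrable_bound[OF V_int])
        show "AE \<xi> in lborel. norm (K ^ i * (norm \<xi> powr (s - real i) * cmod (ft_deriv e q f \<xi>)))
            \<le> norm (D * R powr s * (indicator (cball 0 R) \<xi> * norm \<xi> powr (1 - ?n)))"
          using K by (intro AE_I2) (simp add: abs_mult le D(1))
      qed measurable
      then show int': "integrable lborel (\<lambda>\<xi>. norm \<xi> powr (s - real i) * cmod (ft_deriv e q f \<xi>))"
        using K by (subst (asm) integrable_mult_left_iff) auto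
      have "K ^ i * J' i q = (LINT \<xi>|lborel. K ^ i * (norm \<xi> powr (s - real i) * cmod (ft_deriv e q f \<xi>)))"
        by (simp add: J'_def)
      also have "\<dots> \<le> (LINT \<xi>::'a|lborel. D * R powr s * (indicator (cball 0 R) \<xi> * norm \<xi> powr (1 - ?n)))"
        by (rule integral_mono[OF integrable_mult_right[OF int'] V_int le])
      finally show "K ^ i * J' i q \<le> D * R powr s * V"
        by (simp add: V_def)
    qed
    have J_lim: "(\<lambda>n. J n i q) \<longlonglongrightarrow> J' i q" if iq: "i \<le> M" "q \<le> M" for i q
      unfolding J_def J'_def
    proof (rule integral_dominated_convergence)
      let ?b = "(s - real i) / 2"
      \<comment> \<open>The two summands serve the two signs of the exponent: on the ball
        \<open>w n \<xi>\<close> lies between |\<xi>|^2 and 1 + R^2.\<close>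
      show "integrable lborel (\<lambda>\<xi>. (1 + R\<^sup>2) powr ?b * cmod (ft_deriv e q f \<xi>)
          + norm \<xi> powr (s - real i) * cmod (ft_deriv e q f \<xi>))"
        unfolding ft_deriv_def[of e q f]
        by (intro Bochner_Integration.integrable_add integrable_mult_right integrable_norm
            int'[OF iq, unfolded ft_deriv_def]
            integrable_continuous_compact_support[where R = R] continuous_on_ft_deriv[OF f, unfolded ft_deriv_def]
            ft_deriv_vanishes[OF f van, unfolded ft_deriv_def])
      show "AE \<xi> in lborel. (\<lambda>n. w n \<xi> powr ?b * cmod (ft_deriv e q f \<xi>))
          \<longlonglongrightarrow> norm \<xi> powr (s - real i) * cmod (ft_deriv e q f \<xi>)"
        using AE_lborel_singleton[of 0] by eventually_elim (intro tendsto_intros w_lim)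
      show "AE \<xi> in lborel. norm (w n \<xi> powr ?b * cmod (ft_deriv e q f \<xi>))
          \<le> (1 + R\<^sup>2) powr ?b * cmod (ft_deriv e q f \<xi>) + norm \<xi> powr (s - real i) * cmod (ft_deriv e q f \<xi>)" for n
        using AE_lborel_singleton[of 0]
      proof eventually_elim
        case (elim \<xi>)
        show ?case
        proof (cases "norm \<xi> \<le> R")
          case True
          have "w n \<xi> powr ?b \<le> (1 + R\<^sup>2) powr ?b + norm \<xi> powr (s - real i)"
          proof (cases "?b \<ge> 0")
            case True
            then have "w n \<xi> powr ?b \<le> (1 + R\<^sup>2) powr ?b"
              using w_le[OF \<open>norm \<xi> \<le> R\<close>, of n] w_pos[of n \<xi>] by (intro powr_mono2) auto
            then show ?thesis
              by (simp add: add_increasing2)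
          next
            case False
            have "w n \<xi> powr ?b \<le> ((norm \<xi>)\<^sup>2) powr ?b"
              using False elim by (intro powr_mono2') (auto simp: w_def)
            also have "\<dots> = norm \<xi> powr (s - real i)"
              using elim by (simp add: powr_powr diff_divide_distrib flip: powr_numeral)
            finally show ?thesis
              by (intro add_increasing) auto
          qed
          then show ?thesis
            by (simp add: abs_mult mult_right_mono flip: distrib_right)
        next
          case False
          then show ?thesis
            using ft_deriv_vanishes[OF f van, where \<xi> = \<xi>] by simp
        qed
      qed
    qed (simp_all add: w_def)
    \<comment> \<open>A single bound must serve all i, q <= M; for the sum the limit can be taken
      term by term.\<close>
    define B where "B n = (\<Sum>i\<le>M. \<Sum>q\<le>M. K ^ i * J n i q)" for n
    have J_nonneg: "K ^ i * J n i q \<ge> 0" for n i q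
      unfolding J_def using K by (intro mult_nonneg_nonneg integral_nonneg_AE) auto
    have B_ge: "K ^ i * J n i q \<le> B n" if "i \<le> M" "q \<le> M" for n i q
    proof -
      have "K ^ i * J n i q \<le> (\<Sum>q\<le>M. K ^ i * J n i q)"
        using that J_nonneg by (intro member_le_sum) auto
      also have "\<dots> \<le> B n"
        unfolding B_def using that J_nonneg
        by (intro member_le_sum[of i _ "\<lambda>i. \<Sum>q\<le>M. K ^ i * J n i q"]) (auto intro: sum_nonneg)
      finally show ?thesis .
    qed
    have B_lim: "(\<lambda>n. 2 ^ M * B n) \<longlonglongrightarrow> 2 ^ M * (\<Sum>i\<le>M. \<Sum>q\<le>M. K ^ i * J' i q)"
      unfolding B_def by (intro tendsto_intros J_lim) auto
    have step: "\<bar>x \<bullet> e\<bar> ^ M * cmod (regularized_integral e f x (1 / (real n + 1)) 0 (s / 2) 0) \<le> 2 ^ M * B n" for n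
      using regularized_integral_decay[OF f van _ e K, where \<delta> = "1 / (real n + 1)" and B = "B n" and M = M
          and s = s and i = 0 and j = M and p = 0 and a = "s / 2" and q = 0 and x = x]
        B_ge[of _ _ n] s unfolding J_def w_def K_def by simp
    have "(\<lambda>n. regularized_integral e f x (1 / (real n + 1)) 0 (s / 2) 0) \<longlonglongrightarrow>
        (LINT \<xi>|lborel. exp (\<i> * of_real (x \<bullet> \<xi>)) * (of_real (norm \<xi> powr s) * ft f \<xi>))"
      unfolding regularized_integral_def power_0 mult_1 ft_deriv_0 w_def[symmetric]
    proof (rule integral_dominated_convergence)
      have [measurable]: "ft f \<in> borel_measurable borel"
        using \<open>\<And>q. ft_deriv e q f \<in> borel_measurable borel\<close>[of 0] by simp
      show "integrable lborel (\<lambda>\<xi>. (1 + R\<^sup>2) powr (s / 2) * cmod (ft f \<xi>))"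
        by (intro integrable_mult_right integrable_norm integrable_continuous_compact_support[where R = R]
            continuous_on_ft rapidly_decreasing_integrable f van)
      show "AE \<xi> in lborel. (\<lambda>n. exp (\<i> * of_real (x \<bullet> \<xi>)) * (of_real (w n \<xi> powr (s / 2)) * ft f \<xi>))
          \<longlonglongrightarrow> exp (\<i> * of_real (x \<bullet> \<xi>)) * (of_real (norm \<xi> powr s) * ft f \<xi>)"
        using AE_lborel_singleton[of 0] by eventually_elim (intro tendsto_intros w_lim)
      show "(\<lambda>\<xi>. exp (\<i> * of_real (x \<bullet> \<xi>)) * (of_real (norm \<xi> powr s) * ft f \<xi>)) \<in> borel_measurable lborel"
        by measurable
      show "(\<lambda>\<xi>. exp (\<i> * of_real (x \<bullet> \<xi>)) * (of_real (w n \<xi> powr (s / 2)) * ft f \<xi>)) \<in> borel_measurable lborel" for n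
        unfolding w_def by measurable
      have "norm (exp (\<i> * of_real (x \<bullet> \<xi>)) * (of_real (w n \<xi> powr (s / 2)) * ft f \<xi>))
          \<le> (1 + R\<^sup>2) powr (s / 2) * cmod (ft f \<xi>)" for n \<xi>
      proof (cases "norm \<xi> \<le> R")
        case True
        then show ?thesis
          using w_le[OF True, of n] w_pos[of n \<xi>] s by (simp add: norm_mult mult_right_mono powr_mono2)
      qed (simp add: van)
      then show "AE \<xi> in lborel. norm (exp (\<i> * of_real (x \<bullet> \<xi>)) * (of_real (w n \<xi> powr (s / 2)) * ft f \<xi>))
          \<le> (1 + R\<^sup>2) powr (s / 2) * cmod (ft f \<xi>)" for n
        by simp
    qed
    then have "(\<lambda>n. \<bar>x \<bullet> e\<bar> ^ M * cmod (regularized_integral e f x (1 / (real n + 1)) 0 (s / 2) 0)) \<longlonglongrightarrow>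
        \<bar>x \<bullet> e\<bar> ^ M * cmod (LINT \<xi>|lborel. exp (\<i> * of_real (x \<bullet> \<xi>)) * (of_real (norm \<xi> powr s) * ft f \<xi>))"
      by (intro tendsto_intros)
    then have "\<bar>x \<bullet> e\<bar> ^ M * cmod (LINT \<xi>|lborel. exp (\<i> * of_real (x \<bullet> \<xi>)) * (of_real (norm \<xi> powr s) * ft f \<xi>))
        \<le> 2 ^ M * (\<Sum>i\<le>M. \<Sum>q\<le>M. K ^ i * J' i q)"
      by (rule LIMSEQ_le[OF _ B_lim]) (use step in auto)
    also have "\<dots> \<le> 2 ^ M * (\<Sum>i\<le>M. \<Sum>q\<le>M. D * R powr s * V)"
      by (intro mult_left_mono sum_mono J'_le) auto
    also have "\<dots> = 2 ^ M * ((real M + 1)\<^sup>2 * (D * V)) * R powr s"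
      by (simp add: power2_eq_square algebra_simps)
    finally show "\<bar>x \<bullet> e\<bar> ^ M * cmod (LINT \<xi>|lborel. exp (\<i> * of_real (x \<bullet> \<xi>)) * (of_real (norm \<xi> powr s) * ft f \<xi>))
        \<le> 2 ^ M * ((real M + 1)\<^sup>2 * (D * V)) * R powr s" .
  qed
qed

section \<open>Fourier inversion with a Gaussian\<close>

text \<open>Up to the factor \<open>sqrt (2 * pi)\<close> this is the characteristic function of the
  standard normal distribution.\<close>

lemma
  shows integrable_gaussian_iexp_real: "integrable lborel (\<lambda>x::real. exp (\<i> * of_real (x * t)) * of_real (exp (- x\<^sup>2 / 2)))"
    and integral_gaussian_iexp_real: "(LINT x|lborel. exp (\<i> * of_real (x * t)) * of_real (exp (- x\<^sup>2 / 2)))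
      = complex_of_real (sqrt (2 * pi) * exp (- t\<^sup>2 / 2))"
proof -
  have eq: "exp (\<i> * of_real (x * t)) * of_real (exp (- x\<^sup>2 / 2))
      = of_real (sqrt (2 * pi)) * (std_normal_density x *\<^sub>R exp (\<i> * of_real (t * x)))" for x
    by (simp add: std_normal_density_def scaleR_conv_of_real mult_ac)
  have "integrable lborel (\<lambda>x. std_normal_density x *\<^sub>R exp (\<i> * complex_of_real (t * x)))"
    by (rule Bochner_Integration.integrable_bound[of _ std_normal_density]) auto
  then show "integrable lborel (\<lambda>x::real. exp (\<i> * of_real (x * t)) * of_real (exp (- x\<^sup>2 / 2)))"
    unfolding eq by (rule integrable_mult_right)
  have "(LINT x|lborel. std_normal_density x *\<^sub>R exp (\<i> * complex_of_real (t * x))) = char std_normal_distribution t"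
    unfolding char_def by (subst integral_density) auto
  also have "\<dots> = complex_of_real (exp (- t\<^sup>2 / 2))"
    by (simp add: char_std_normal_distribution)
  finally have *: "(LINT x|lborel. std_normal_density x *\<^sub>R exp (\<i> * complex_of_real (t * x))) =
      complex_of_real (exp (- t\<^sup>2 / 2))" .
  show "(LINT x|lborel. exp (\<i> * of_real (x * t)) * of_real (exp (- x\<^sup>2 / 2)))
      = complex_of_real (sqrt (2 * pi) * exp (- t\<^sup>2 / 2))"
    unfolding eq integral_mult_right_zero * by simp
qed

lemma
  fixes y :: "'a::euclidean_space"
  shows integrable_gaussian_iexp: "integrable lborel (\<lambda>x. exp (\<i> * of_real (x \<bullet> y)) * of_real (exp (- (norm x)\<^sup>2 / 2)))"
    and integral_gaussian_iexp: "(LINT x|lborel. exp (\<i> * of_real (x \<bullet> y)) * of_real (exp (- (norm x)\<^sup>2 / 2)))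
      = complex_of_real (sqrt (2 * pi) ^ DIM('a) * exp (- (norm y)\<^sup>2 / 2))"
proof -
  define f where "f b x = exp (\<i> * of_real (x * (y \<bullet> b))) * complex_of_real (exp (- x\<^sup>2 / 2))" for b x
  have f: "integrable lborel (f b)" "(LINT x|lborel. f b x) = complex_of_real (sqrt (2 * pi) * exp (- (y \<bullet> b)\<^sup>2 / 2))" for b
    unfolding f_def by (rule integrable_gaussian_iexp_real integral_gaussian_iexp_real)+
  have gauss: "(\<Prod>b\<in>Basis. exp (- (x \<bullet> b)\<^sup>2 / 2)) = exp (- (norm x)\<^sup>2 / 2)" for x :: 'a
  proof -
    have "(norm x)\<^sup>2 = (\<Sum>b\<in>Basis. (x \<bullet> b)\<^sup>2)"
      by (subst power2_norm_eq_inner, subst euclidean_inner) (simp add: power2_eq_square)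
    then show ?thesis
      by (simp add: sum_divide_distrib sum_negf flip: exp_sum)
  qed
  have eq: "(\<Prod>b\<in>Basis. f b (x \<bullet> b)) = exp (\<i> * of_real (x \<bullet> y)) * of_real (exp (- (norm x)\<^sup>2 / 2))" for x
    unfolding f_def prod.distrib of_real_prod[symmetric] gauss
    by (simp add: euclidean_inner[of x y] sum_distrib_left flip: exp_sum)
  show "integrable lborel (\<lambda>x. exp (\<i> * of_real (x \<bullet> y)) * of_real (exp (- (norm x)\<^sup>2 / 2)))"
    unfolding eq[symmetric] by (intro integrable_lborel_prod f)
  show "(LINT x|lborel. exp (\<i> * of_real (x \<bullet> y)) * of_real (exp (- (norm x)\<^sup>2 / 2)))
      = complex_of_real (sqrt (2 * pi) ^ DIM('a) * exp (- (norm y)\<^sup>2 / 2))"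
    unfolding eq[symmetric] by (subst integral_lborel_prod) (simp_all add: f prod.distrib gauss[simplified] flip: of_real_prod)
qed

text \<open>
  Integrating \<open>g (\<xi> + \<epsilon> \<eta>) exp (i \<eta>\<bullet>y) exp (-\<bar>y\<bar>\<^sup>2/2)\<close> first over \<open>y\<close> gives a Gaussian mean of \<open>g\<close> near
  \<open>\<xi>\<close>; integrating first over \<open>\<eta>\<close> gives a rescaling of the inverse transform of \<open>g\<close>, whose
  \<open>L\<^sup>1\<close> norm does not depend on \<open>\<epsilon>\<close>.
\<close>

lemma norm_le_integral_inverse_transform:
  fixes g :: "'a::euclidean_space \<Rightarrow> complex"
  assumes g: "integrable lborel g" and bounded: "\<And>\<xi>. cmod (g \<xi>) \<le> b" and cont: "isCont g \<xi>"
    and W: "integrable lborel W"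
    and bound: "\<And>x. cmod (LINT \<xi>|lborel. exp (\<i> * of_real (x \<bullet> \<xi>)) * g \<xi>) \<le> W x"
  shows "(2 * pi) ^ DIM('a) * cmod (g \<xi>) \<le> (LINT x|lborel. W x)"
proof -
  let ?c = "sqrt (2 * pi) ^ DIM('a)"
  define \<gamma> where "\<gamma> = (\<lambda>y::'a. exp (- (norm y)\<^sup>2 / 2))"
  have [measurable]: "g \<in> borel_measurable borel" "\<gamma> \<in> borel_measurable borel" "W \<in> borel_measurable borel"
    using g W unfolding \<gamma>_def by auto
  have \<gamma>_int: "integrable lborel (\<lambda>y. complex_of_real (\<gamma> y))" and \<gamma>_eq: "(LINT y|lborel. complex_of_real (\<gamma> y)) = of_real ?c"
    using integrable_gaussian_iexp[of "0::'a"] integral_gaussian_iexp[of "0::'a"] unfolding \<gamma>_def by simp_all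
  have \<gamma>_int': "integrable lborel \<gamma>"
    using integrable_norm[OF \<gamma>_int] by (simp add: \<gamma>_def)
  have mean_le: "cmod (LINT \<eta>|lborel. g (\<xi> + \<epsilon> *\<^sub>R \<eta>) * (of_real ?c * of_real (\<gamma> \<eta>))) \<le> (LINT x|lborel. W x)"
    if \<epsilon>: "\<epsilon> > 0" for \<epsilon>
  proof -
    define \<Phi> where "\<Phi> y \<eta> = g (\<xi> + \<epsilon> *\<^sub>R \<eta>) * (exp (\<i> * of_real (y \<bullet> \<eta>)) * of_real (\<gamma> y))" for y \<eta>
    have g': "integrable lborel (\<lambda>\<eta>. g (\<xi> + \<epsilon> *\<^sub>R \<eta>))"
      using \<epsilon> by (intro integrable_affine g) simp
    have \<Phi>: "integrable (lborel \<Otimes>\<^sub>M lborel) (\<lambda>(y, \<eta>). \<Phi> y \<eta>)"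
    proof (rule lborel_pair.Fubini_integrable)
      show "(\<lambda>(y, \<eta>). \<Phi> y \<eta>) \<in> borel_measurable (lborel \<Otimes>\<^sub>M lborel)"
        unfolding \<Phi>_def by measurable
      have "(LINT \<eta>|lborel. norm (\<Phi> y \<eta>)) = (LINT \<eta>|lborel. cmod (g (\<xi> + \<epsilon> *\<^sub>R \<eta>))) * \<gamma> y" for y
        by (simp add: \<Phi>_def norm_mult \<gamma>_def)
      then show "integrable lborel (\<lambda>y. LINT \<eta>|lborel. norm (case (y, \<eta>) of (y, \<eta>) \<Rightarrow> \<Phi> y \<eta>))"
        using \<gamma>_int' by simp
      have [measurable]: "\<Phi> y \<in> borel_measurable borel" for y
        unfolding \<Phi>_def by measurable
      have "integrable lborel (\<Phi> y)" for y
        by (rule Bochner_Integration.integrable_bound[OF integrable_mult_left[OF g', of "of_real (\<gamma> y)"]])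
          (auto simp: \<Phi>_def norm_mult)
      then show "AE y in lborel. integrable lborel (\<lambda>\<eta>. case (y, \<eta>) of (y, \<eta>) \<Rightarrow> \<Phi> y \<eta>)"
        by simp
    qed
    have inner: "cmod (LINT \<eta>|lborel. \<Phi> y \<eta>) \<le> W (0 + (1 / \<epsilon>) *\<^sub>R y) / \<epsilon> ^ DIM('a)" for y
    proof -
      \<comment> \<open>The substitution \<zeta> = \<xi> + \<epsilon> \<eta> turns the inner
        integral into the unnormalized inverse transform of \<open>g\<close> at y / \<epsilon>,
        times a phase of modulus 1 and \<gamma> y <= 1.\<close>
      define G where "G \<zeta> = exp (- (\<i> * of_real (((1 / \<epsilon>) *\<^sub>R y) \<bullet> \<xi>))) * of_real (\<gamma> y) * (exp (\<i> * of_real (((1 / \<epsilon>) *\<^sub>R y) \<bullet> \<zeta>)) * g \<zeta>)" for \<zeta>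
      have "\<Phi> y \<eta> = G (\<xi> + \<epsilon> *\<^sub>R \<eta>)" for \<eta>
      proof -
        have "exp (\<i> * complex_of_real (y \<bullet> \<eta>)) = exp (- (\<i> * of_real (((1 / \<epsilon>) *\<^sub>R y) \<bullet> \<xi>))) *
            exp (\<i> * of_real (((1 / \<epsilon>) *\<^sub>R y) \<bullet> (\<xi> + \<epsilon> *\<^sub>R \<eta>)))"
          unfolding exp_add[symmetric] using \<epsilon> by (simp add: inner_add_right algebra_simps)
        then show ?thesis
          by (simp add: \<Phi>_def G_def)
      qed
      moreover have "integrable lborel G"
        unfolding G_def by (intro integrable_mult_right integrable_character_mult(2) g)
      ultimately have "(LINT \<eta>|lborel. \<Phi> y \<eta>) = (LINT \<zeta>|lborel. G \<zeta>) /\<^sub>R \<bar>\<epsilon>\<bar> ^ DIM('a)"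
        using integrable_affine(2)[of G \<epsilon> \<xi>] \<epsilon> by simp
      then have "cmod (LINT \<eta>|lborel. \<Phi> y \<eta>) = cmod (LINT \<zeta>|lborel. G \<zeta>) / \<epsilon> ^ DIM('a)"
        using \<epsilon> by (simp add: divide_inverse mult.commute norm_power)
      moreover have "cmod (LINT \<zeta>|lborel. G \<zeta>) \<le> W ((1 / \<epsilon>) *\<^sub>R y)"
      proof -
        have "cmod (LINT \<zeta>|lborel. G \<zeta>) = \<gamma> y * cmod (LINT \<zeta>|lborel. exp (\<i> * of_real (((1 / \<epsilon>) *\<^sub>R y) \<bullet> \<zeta>)) * g \<zeta>)"
          unfolding G_def integral_mult_right_zero norm_mult by (simp add: \<gamma>_def)
        also have "\<dots> \<le> 1 * W ((1 / \<epsilon>) *\<^sub>R y)"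
          by (intro mult_mono bound) (auto simp: \<gamma>_def)
        finally show ?thesis by simp
      qed
      ultimately show ?thesis
        using \<epsilon> by (simp add: divide_right_mono)
    qed
    have "(LINT \<eta>|lborel. g (\<xi> + \<epsilon> *\<^sub>R \<eta>) * (of_real ?c * of_real (\<gamma> \<eta>))) = (LINT \<eta>|lborel. LINT y|lborel. \<Phi> y \<eta>)"
      unfolding \<Phi>_def \<gamma>_def integral_mult_right_zero integral_gaussian_iexp by simp
    also have "\<dots> = (LINT y|lborel. LINT \<eta>|lborel. \<Phi> y \<eta>)"
      using lborel_pair.Fubini_integral[OF \<Phi>] by simp
    also have "cmod \<dots> \<le> (LINT y|lborel. cmod (LINT \<eta>|lborel. \<Phi> y \<eta>))"
      by (rule integral_norm_bound)
    also have "\<dots> \<le> (LINT y|lborel. W (0 + (1 / \<epsilon>) *\<^sub>R y) / \<epsilon> ^ DIM('a))"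
      using lborel_pair.integrable_fst[OF \<Phi>] \<epsilon>
      by (intro integral_mono inner integrable_divide_zero integrable_affine W integrable_norm) auto
    also have "\<dots> = (LINT x|lborel. W x)"
      using integrable_affine(2)[OF W, of "1 / \<epsilon>" 0] \<epsilon> by (simp add: power_one_over field_simps)
    finally show ?thesis .
  qed
  \<comment> \<open>As the scale tends to 0 the Gaussian mean concentrates at \<xi>, where
    \<open>g\<close> is continuous; boundedness of \<open>g\<close> gives the dominating
    function.\<close>
  have "(\<lambda>k. LINT \<eta>|lborel. g (\<xi> + (1 / (real k + 1)) *\<^sub>R \<eta>) * (of_real ?c * of_real (\<gamma> \<eta>)))
      \<longlonglongrightarrow> (LINT \<eta>|lborel. g \<xi> * (of_real ?c * of_real (\<gamma> \<eta>)))"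
  proof (rule integral_dominated_convergence)
    show "integrable lborel (\<lambda>\<eta>. b * (?c * \<gamma> \<eta>))"
      using \<gamma>_int' by simp
    have "(\<lambda>k. 1 / (real k + 1)) \<longlonglongrightarrow> 0"
      using LIMSEQ_inverse_real_of_nat by (simp add: inverse_eq_divide add.commute)
    then have "(\<lambda>k. \<xi> + (1 / (real k + 1)) *\<^sub>R \<eta>) \<longlonglongrightarrow> \<xi> + 0 *\<^sub>R \<eta>" for \<eta>
      by (intro tendsto_intros)
    then have "(\<lambda>k. g (\<xi> + (1 / (real k + 1)) *\<^sub>R \<eta>)) \<longlonglongrightarrow> g \<xi>" for \<eta>
      by (intro isCont_tendsto_compose[OF cont]) simp
    then show "AE \<eta> in lborel. (\<lambda>k. g (\<xi> + (1 / (real k + 1)) *\<^sub>R \<eta>) * (of_real ?c * of_real (\<gamma> \<eta>)))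
        \<longlonglongrightarrow> g \<xi> * (of_real ?c * of_real (\<gamma> \<eta>))"
      by (intro AE_I2 tendsto_mult tendsto_const)
    have "cmod (g \<zeta> * (of_real ?c * of_real (\<gamma> \<eta>))) \<le> b * (?c * \<gamma> \<eta>)" for \<zeta> \<eta>
      using mult_right_mono[OF bounded[of \<zeta>], of "?c * \<gamma> \<eta>"] by (simp add: norm_mult norm_power \<gamma>_def)
    then show "AE \<eta> in lborel. norm (g (\<xi> + (1 / (real k + 1)) *\<^sub>R \<eta>) * (of_real ?c * of_real (\<gamma> \<eta>))) \<le> b * (?c * \<gamma> \<eta>)" for k
      by (intro AE_I2)
  qed measurable
  then have "cmod (LINT \<eta>|lborel. g \<xi> * (of_real ?c * of_real (\<gamma> \<eta>))) \<le> (LINT x|lborel. W x)"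
    by (rule LIMSEQ_le_const2[OF tendsto_norm]) (intro exI allI impI mean_le, simp)
  also have "(LINT \<eta>|lborel. g \<xi> * (of_real ?c * of_real (\<gamma> \<eta>))) = g \<xi> * of_real (?c * ?c)"
    unfolding integral_mult_right_zero \<gamma>_eq by simp
  \<comment> \<open>One factor comes from the integral over y, the other from the total mass of the
    Gaussian in \<eta>.\<close>
  also have "?c * ?c = (2 * pi) ^ DIM('a)"
    unfolding power_mult_distrib[symmetric] real_sqrt_mult_self by simp
  finally show ?thesis
    by (simp add: norm_mult norm_power mult.commute)
qed

section \<open>Components of Clifford-valued functions\<close>

lemma
  fixes F :: "'a \<Rightarrow> complex ^ 'k::finite"
  assumes F: "\<And>A. integrable M (\<lambda>x. F x $ A)"
  shows integrable_vec: "integrable M F"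
    and integral_vec_nth: "(LINT x|M. F x) $ A = (LINT x|M. F x $ A)"
proof -
  have "bounded_linear (axis A :: complex \<Rightarrow> complex ^ 'k)" for A
    unfolding linear_conv_bounded_linear[symmetric]
    by (rule linearI) (auto simp: axis_def vec_eq_iff)
  then have "integrable M (\<lambda>x. \<Sum>A\<in>UNIV. axis A (F x $ A))"
    by (intro Bochner_Integration.integrable_sum, rule integrable_bounded_linear[OF _ F])
  also have "(\<lambda>x. \<Sum>A\<in>UNIV. axis A (F x $ A)) = F"
    by (intro ext, simp add: vec_eq_iff axis_def)
  finally show "integrable M F" .
  then show "(LINT x|M. F x) $ A = (LINT x|M. F x $ A)"
    by (rule integral_bounded_linear[OF bounded_linear_vec_nth, symmetric])
qed

lemma cl_norm_eq: "cl_norm (v :: 'n::finite clifford) = 2 powr (real CARD('n) / 2) * norm v"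
  by (simp add: cl_norm_def norm_vec_def L2_set_def)

lemma cl_norm_scaleR: "cl_norm (c *\<^sub>R v) = \<bar>c\<bar> * cl_norm v"
  by (simp add: cl_norm_eq)

lemma cmod_nth_le_cl_norm: "cmod (v $ A) \<le> cl_norm (v :: 'n::finite clifford)"
proof -
  have "cmod (v $ A) \<le> 1 * norm v"
    by (simp add: Finite_Cartesian_Product.norm_nth_le)
  also have "\<dots> \<le> 2 powr (real CARD('n) / 2) * norm v"
    by (intro mult_right_mono ge_one_powr_ge_zero) auto
  finally show ?thesis by (simp add: cl_norm_eq)
qed

lemma cl_norm_le_sum: "cl_norm (v :: 'n::finite clifford) \<le> 2 powr (real CARD('n) / 2) * (\<Sum>A\<in>UNIV. cmod (v $ A))"
  unfolding cl_norm_eq norm_vec_def by (intro mult_left_mono L2_set_le_sum) auto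

lemma fourier_nth:
  fixes \<psi> :: "real ^ 'n::finite \<Rightarrow> 'n clifford"
  assumes "clifford_schwartz \<psi>"
  shows "fourier \<psi> \<xi> $ A = ft (\<lambda>x. \<psi> x $ A) \<xi>"
proof -
  have "integrable lborel (\<lambda>x. (exp (- \<i> * of_real (x \<bullet> \<xi>)) *s \<psi> x) $ A)" for A
    using assms integrable_character_mult(1)[OF rapidly_decreasing_integrable[OF
        schwartz_rapidly_decreasing[of "\<lambda>x. \<psi> x $ A" "[]"]], of \<xi>]
    by (simp add: clifford_schwartz_def)
  from integral_vec_nth[OF this] show ?thesis
    by (simp add: fourier_def ft_def)
qed

text \<open>As \<alpha> <= 1, the symbol is at most (1 + |\<xi>|)^k. So the integrals behind the
  operator converge without any support condition.\<close>

lemma rapidly_decreasing_symbol_ft: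
  fixes f :: "real ^ 'n::finite \<Rightarrow> complex"
  assumes f: "schwartz f" and \<alpha>: "0 < \<alpha>" "\<alpha> \<le> 1"
  shows "rapidly_decreasing (\<lambda>\<xi>. of_real ((norm \<xi> powr \<alpha>) ^ k) * ft f \<xi>)"
proof (rule rapidly_decreasing_mult[OF rapidly_decreasing_ft[OF f], where c = 1 and k = k])
  show "cmod (of_real ((norm \<xi> powr \<alpha>) ^ k)) \<le> 1 * (1 + norm \<xi>) ^ k" for \<xi> :: "real ^ 'n"
  proof -
    have "norm \<xi> powr \<alpha> \<le> (1 + norm \<xi>) powr \<alpha>"
      using \<alpha> by (intro powr_mono2) auto
    also have "\<dots> \<le> (1 + norm \<xi>) powr 1"
      using \<alpha> by (intro powr_mono) auto
    finally have "(norm \<xi> powr \<alpha>) ^ k \<le> (1 + norm \<xi>) ^ k"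
      by (intro power_mono) auto
    then show ?thesis
      by (simp add: norm_power)
  qed
qed measurable

text \<open>A component of \<open>frac_laplacian_power\<close> before division by (2 pi)^n, see
  \<open>frac_laplacian_power_nth\<close>.\<close>

definition symbol_integral :: "real \<Rightarrow> nat \<Rightarrow> (real ^ 'n::finite \<Rightarrow> complex) \<Rightarrow> real ^ 'n \<Rightarrow> complex" where
  "symbol_integral \<alpha> k f x = (LINT \<xi>|lborel. exp (\<i> * of_real (x \<bullet> \<xi>)) * (of_real ((norm \<xi> powr \<alpha>) ^ k) * ft f \<xi>))"

lemma frac_laplacian_power_nth:
  fixes \<psi> :: "real ^ 'n::finite \<Rightarrow> 'n clifford"
  assumes \<psi>: "clifford_schwartz \<psi>" and \<alpha>: "0 < \<alpha>" "\<alpha> \<le> 1"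
  shows "frac_laplacian_power \<alpha> k \<psi> x $ A = symbol_integral \<alpha> k (\<lambda>x. \<psi> x $ A) x /\<^sub>R (2 * pi) ^ CARD('n)"
proof -
  have eq: "(exp (\<i> * of_real (x \<bullet> \<xi>)) *s ((norm \<xi> powr \<alpha>) ^ k *\<^sub>R fourier \<psi> \<xi>)) $ A
      = exp (\<i> * of_real (x \<bullet> \<xi>)) * (of_real ((norm \<xi> powr \<alpha>) ^ k) * ft (\<lambda>x. \<psi> x $ A) \<xi>)" for A \<xi>
    unfolding vector_smult_component vector_scaleR_component fourier_nth[OF \<psi>]
    by (simp add: scaleR_conv_of_real)
  have "integrable lborel (\<lambda>\<xi>. (exp (\<i> * of_real (x \<bullet> \<xi>)) *s ((norm \<xi> powr \<alpha>) ^ k *\<^sub>R fourier \<psi> \<xi>)) $ A)" for A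
    unfolding eq using \<psi> \<alpha>
    by (intro integrable_character_mult(2) rapidly_decreasing_integrable rapidly_decreasing_symbol_ft)
      (auto simp: clifford_schwartz_def)
  from integral_vec_nth[OF this, of A, unfolded eq] show ?thesis
    unfolding frac_laplacian_power_def fourier_multiplier_def inverse_fourier_def symbol_integral_def
      vector_scaleR_component by (simp only: inverse_eq_divide)
qed

lemma cmod_frac_laplacian_power_nth:
  fixes \<psi> :: "real ^ 'n::finite \<Rightarrow> 'n clifford"
  assumes "clifford_schwartz \<psi>" "0 < \<alpha>" "\<alpha> \<le> 1"
  shows "cmod (frac_laplacian_power \<alpha> k \<psi> x $ A) =
    cmod (symbol_integral \<alpha> k (\<lambda>x. \<psi> x $ A) x) / (2 * pi) ^ CARD('n)"
proof -
  have *: "norm (c /\<^sub>R d) = norm c / d" if "d > 0" for c :: complex and d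
    using that by (simp add: divide_inverse mult.commute)
  show ?thesis
    unfolding frac_laplacian_power_nth[OF assms] by (rule *) simp
qed

text \<open>For k = 0 the symbols differ at the origin, where (0 powr \<alpha>)^0 = 1 but
  \<open>0 powr 0 = 0\<close>. A single point does not affect the integral.\<close>

lemma symbol_integral_eq_powr:
  assumes f [measurable]: "ft f \<in> borel_measurable borel"
  shows "symbol_integral \<alpha> k f x = (LINT \<xi>|lborel. exp (\<i> * of_real (x \<bullet> \<xi>)) * (of_real (norm \<xi> powr (\<alpha> * real k)) * ft f \<xi>))"
proof -
  have "AE \<xi> in lborel. exp (\<i> * of_real (x \<bullet> \<xi>)) * (of_real ((norm \<xi> powr \<alpha>) ^ k) * ft f \<xi>)
      = exp (\<i> * of_real (x \<bullet> \<xi>)) * (of_real (norm \<xi> powr (\<alpha> * real k)) * ft f \<xi>)"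
    using AE_lborel_singleton[of 0] by eventually_elim (simp only: frac_laplacian_symbol not_False_eq_True)
  then show ?thesis
    unfolding symbol_integral_def using f by (intro integral_cong_AE) measurable
qed

section \<open>The two implications for one component\<close>

text \<open>\<open>power_1_plus_sum_le\<close> splits the weight into 1 and the powers |x_j|^(2 m).
  These are handled by \<open>multiplier_decay\<close> with M = 0 and, in each coordinate direction,
  with M = 2 m.\<close>

lemma symbol_integral_decay:
  fixes f :: "real ^ 'n::finite \<Rightarrow> complex"
  assumes f: "schwartz f" and van: "\<And>\<xi>. norm \<xi> > R \<Longrightarrow> ft f \<xi> = 0"
    and \<alpha>: "0 < \<alpha>"
  shows "\<exists>C\<ge>0. \<forall>k x. \<alpha> * real k > 2 * real m + 1 - real CARD('n) \<longrightarrow>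
      (1 + (norm x)\<^sup>2) ^ m * cmod (symbol_integral \<alpha> k f x) \<le> C * R powr (\<alpha> * real k)"
proof -
  let ?H = "symbol_integral \<alpha>"
  have f': "rapidly_decreasing f"
    using schwartz_rapidly_decreasing[OF f, of "[]"] by simp
  have ft_meas: "ft f \<in> borel_measurable borel"
    by (rule rapidly_decreasing_measurable[OF rapidly_decreasing_ft[OF f]])
  have decay: "\<exists>C\<ge>0. \<forall>k x. \<alpha> * real k > real M + 1 - real CARD('n) \<longrightarrow>
      \<bar>x $ j\<bar> ^ M * cmod (?H k f x) \<le> C * R powr (\<alpha> * real k)" for M and j :: 'n
  proof -
    obtain C where "C \<ge> 0" "\<And>s x. 0 \<le> s \<Longrightarrow> s > real M + 1 - real DIM(real ^ 'n) \<Longrightarrow>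
      \<bar>x \<bullet> axis j 1\<bar> ^ M * cmod (LINT \<xi>|lborel. exp (\<i> * of_real (x \<bullet> \<xi>)) * (of_real (norm \<xi> powr s) * ft f \<xi>))
        \<le> C * R powr s"
      using f' multiplier_decay[OF f' van, where e = "axis j 1 :: real ^ 'n" and M = M] by (auto simp: norm_axis_1)
    then show ?thesis
      using \<alpha> by (intro exI[of _ C]) (auto simp: symbol_integral_eq_powr[OF ft_meas] inner_axis)
  qed
  \<comment> \<open>The direction is arbitrary here because the coordinate enters with the power
    0.\<close>
  obtain C0 where C0: "C0 \<ge> 0" "\<And>k x. \<alpha> * real k > 1 - real CARD('n) \<Longrightarrow> cmod (?H k f x) \<le> C0 * R powr (\<alpha> * real k)"
    using decay[of 0 undefined] by auto
  obtain C where C: "\<And>j. C j \<ge> 0" "\<And>j k x. \<alpha> * real k > 2 * real m + 1 - real CARD('n) \<Longrightarrow>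
      \<bar>x $ j\<bar> ^ (2 * m) * cmod (?H k f x) \<le> C j * R powr (\<alpha> * real k)"
  proof -
    have "\<exists>C\<ge>0. \<forall>k x. \<alpha> * real k > 2 * real m + 1 - real CARD('n) \<longrightarrow>
        \<bar>x $ j\<bar> ^ (2 * m) * cmod (?H k f x) \<le> C * R powr (\<alpha> * real k)" for j
      using decay[of "2 * m" j] by simp
    then show ?thesis
      using that by metis
  qed
  let ?c = "(real CARD('n) + 1) ^ m * (C0 + (\<Sum>j\<in>UNIV. C j))"
  show ?thesis
  proof (intro exI conjI allI impI)
    show "?c \<ge> 0"
      using C0 C by (auto intro!: mult_nonneg_nonneg add_nonneg_nonneg sum_nonneg)
    fix k and x :: "real ^ 'n" assume k: "\<alpha> * real k > 2 * real m + 1 - real CARD('n)"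
    have "(norm x)\<^sup>2 = (\<Sum>j\<in>UNIV. (x $ j)\<^sup>2)"
      by (simp add: norm_vec_def L2_set_def sum_nonneg)
    then have "(1 + (norm x)\<^sup>2) ^ m \<le> (real CARD('n) + 1) ^ m * (1 + (\<Sum>j\<in>UNIV. ((x $ j)\<^sup>2) ^ m))"
      using power_1_plus_sum_le[of "\<lambda>j. (x $ j)\<^sup>2" m] by simp
    also have "(\<lambda>j. ((x $ j)\<^sup>2) ^ m) = (\<lambda>j. \<bar>x $ j\<bar> ^ (2 * m))"
      by (simp add: fun_eq_iff power_mult)
    finally have "(1 + (norm x)\<^sup>2) ^ m * cmod (?H k f x)
        \<le> (real CARD('n) + 1) ^ m * (1 + (\<Sum>j\<in>UNIV. \<bar>x $ j\<bar> ^ (2 * m))) * cmod (?H k f x)"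
      by (rule mult_right_mono) simp
    also have "\<dots> = (real CARD('n) + 1) ^ m * (cmod (?H k f x) + (\<Sum>j\<in>UNIV. \<bar>x $ j\<bar> ^ (2 * m) * cmod (?H k f x)))"
      by (simp add: distrib_right sum_distrib_right mult.assoc)
    also have "\<dots> \<le> (real CARD('n) + 1) ^ m * (C0 * R powr (\<alpha> * real k) + (\<Sum>j\<in>UNIV. C j * R powr (\<alpha> * real k)))"
      using k by (intro mult_left_mono add_mono sum_mono C0 C) auto
    also have "\<dots> = ?c * R powr (\<alpha> * real k)"
      by (simp add: distrib_right sum_distrib_right mult.assoc)
    finally show "(1 + (norm x)\<^sup>2) ^ m * cmod (?H k f x) \<le> ?c * R powr (\<alpha> * real k)" .
  qed
qed

text \<open>The weight (1 + |x|^2)^(-n) is integrable, so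
  \<open>norm_le_integral_inverse_transform\<close> applies to the symbol times \<open>ft f\<close>.
  If \<open>ft f \<xi>\<close> were nonzero, all large powers of q = (|\<xi>| / R)^\<alpha> > 1
  would stay below one constant.\<close>

lemma ft_vanishes_if_symbol_integrals_bounded:
  fixes f :: "real ^ 'n::finite \<Rightarrow> complex"
  assumes f: "schwartz f" and \<alpha>: "0 < \<alpha>" "\<alpha> \<le> 1" and R: "0 < R"
    and bound: "\<And>k x. \<alpha> * real k > real CARD('n) + 1 \<Longrightarrow>
      (1 + (norm x)\<^sup>2) ^ CARD('n) * cmod (symbol_integral \<alpha> k f x) \<le> C * R powr (\<alpha> * real k)"
    and \<xi>: "norm \<xi> > R"
  shows "ft f \<xi> = 0"
proof (rule ccontr)
  assume nz: "ft f \<xi> \<noteq> 0"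
  define V where "V = (LINT x::real^'n|lborel. 1 / (1 + (norm x)\<^sup>2) ^ CARD('n))"
  define q where "q = (norm \<xi> / R) powr \<alpha>"
  have q: "q > 1"
    unfolding q_def using R \<xi> \<alpha> by (intro gr_one_powr) auto
  have upper: "q ^ k \<le> C * V / ((2 * pi) ^ CARD('n) * cmod (ft f \<xi>))" if k: "\<alpha> * real k > real CARD('n) + 1" for k
  proof -
    define g where "g \<xi> = of_real ((norm \<xi> powr \<alpha>) ^ k) * ft f \<xi>" for \<xi>
    have g: "rapidly_decreasing g"
      unfolding g_def by (rule rapidly_decreasing_symbol_ft[OF f \<alpha>])
    obtain b where b: "cmod (g \<xi>) \<le> b" for \<xi>
      using g unfolding rapidly_decreasing_def by (metis mult_1 power_0)
    have "continuous_on UNIV (ft f)"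
      using schwartz_rapidly_decreasing[OF f, of "[]"] by (intro continuous_on_ft rapidly_decreasing_integrable) simp
    then have "isCont g \<xi>"
      unfolding g_def using \<xi> R by (intro continuous_intros) (auto simp: continuous_on_eq_continuous_at)
    have pos: "1 + (norm x)\<^sup>2 > 0" for x :: "real ^ 'n"
      by (simp add: add_pos_nonneg)
    have "(2 * pi) ^ DIM(real ^ 'n) * cmod (g \<xi>)
        \<le> (LINT x::real^'n|lborel. C * R powr (\<alpha> * real k) * (1 / (1 + (norm x)\<^sup>2) ^ CARD('n)))"
    proof (rule norm_le_integral_inverse_transform[OF rapidly_decreasing_integrable[OF g] b \<open>isCont g \<xi>\<close>])
      show "integrable lborel (\<lambda>x::real^'n. C * R powr (\<alpha> * real k) * (1 / (1 + (norm x)\<^sup>2) ^ CARD('n)))"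
        using integrable_inverse_1_plus_norm_square[where 'a = "real ^ 'n"] by (intro integrable_mult_right) simp
      show "cmod (LINT \<xi>|lborel. exp (\<i> * of_real (x \<bullet> \<xi>)) * g \<xi>)
          \<le> C * R powr (\<alpha> * real k) * (1 / (1 + (norm x)\<^sup>2) ^ CARD('n))" for x
        using bound[OF k, of x] pos[of x] by (simp add: symbol_integral_def g_def field_simps)
    qed
    also have "\<dots> = C * R powr (\<alpha> * real k) * V"
      by (simp only: V_def integral_mult_right_zero)
    finally have "(2 * pi) ^ CARD('n) * ((norm \<xi> powr \<alpha>) ^ k * cmod (ft f \<xi>)) \<le> C * V * R powr (\<alpha> * real k)"
      by (simp add: g_def norm_mult norm_power mult_ac)
    moreover have "R powr (\<alpha> * real k) = (R powr \<alpha>) ^ k"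
      using R by (simp add: powr_powr flip: powr_realpow)
    moreover have "q ^ k = (norm \<xi> powr \<alpha>) ^ k / (R powr \<alpha>) ^ k"
      using R by (simp add: q_def powr_divide power_divide)
    ultimately have "(q ^ k * ((2 * pi) ^ CARD('n) * cmod (ft f \<xi>))) * (R powr \<alpha>) ^ k \<le> C * V * (R powr \<alpha>) ^ k"
      using R by (simp add: mult_ac)
    then have "q ^ k * ((2 * pi) ^ CARD('n) * cmod (ft f \<xi>)) \<le> C * V"
      by (rule mult_right_le_imp_le) (use R in simp)
    then show ?thesis
      using nz by (subst pos_le_divide_eq) auto
  qed
  \<comment> \<open>\<open>k0\<close> makes the bound applicable and \<open>k1\<close> makes the
    power exceed it; their maximum does both.\<close>
  obtain k0 where k0: "\<alpha> * real k0 > real CARD('n) + 1"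
    using ex_less_of_nat_mult[OF \<alpha>(1)] by (auto simp: mult.commute)
  obtain k1 where k1: "q ^ k1 > C * V / ((2 * pi) ^ CARD('n) * cmod (ft f \<xi>))"
    using real_arch_pow[OF q] by blast
  have "q ^ k1 \<le> q ^ max k0 k1"
    using q by (intro power_increasing) auto
  moreover have "\<alpha> * real (max k0 k1) > real CARD('n) + 1"
    using k0 \<alpha> by (smt (verit) mult_left_mono of_nat_mono max.cobounded1)
  ultimately show False
    using upper[of "max k0 k1"] k1 by linarith
qed

section \<open>From components to Clifford-valued functions\<close>

theorem theorem4:
  fixes \<alpha> R :: real
    and \<psi> :: "real ^ 'n::{finite,linorder} \<Rightarrow> 'n clifford"
  assumes "0 < \<alpha>" and "\<alpha> \<le> 1" and "0 < R"
    and "clifford_schwartz \<psi>" and "radially_symmetric \<psi>"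
  shows "closure {\<xi>. fourier \<psi> \<xi> \<noteq> 0} \<subseteq> closure (ball 0 R) \<longleftrightarrow>
    (\<forall>m::nat. \<exists>\<Lambda>::real. 0 < \<Lambda> \<and>
       (\<forall>k::nat. \<alpha> * real k > 2 * real m + 1 - real CARD('n) \<longrightarrow>
          (SUP x. ereal (cl_norm ((1 + (norm x)\<^sup>2) ^ m *\<^sub>R frac_laplacian_power \<alpha> k \<psi> x)))
            \<le> ereal (\<Lambda> * R powr (\<alpha> * real k))))"
  (is "?supp \<longleftrightarrow> (\<forall>m. \<exists>\<Lambda>. ?bound m \<Lambda>)")
proof -
  let ?f = "\<lambda>A x. \<psi> x $ A"
  have schwartz: "schwartz (?f A)" for A
    using assms(4) by (simp add: clifford_schwartz_def)
  note nth = cmod_frac_laplacian_power_nth[OF assms(4,1,2)]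
  \<comment> \<open>The supremum lives in the extended reals, so bounding it is the same as bounding
    pointwise.\<close>
  have sup_iff: "(SUP x. ereal (cl_norm ((1 + (norm x)\<^sup>2) ^ m *\<^sub>R frac_laplacian_power \<alpha> k \<psi> x))) \<le> ereal b \<longleftrightarrow>
      (\<forall>x. (1 + (norm x)\<^sup>2) ^ m * cl_norm (frac_laplacian_power \<alpha> k \<psi> x) \<le> b)" for m k b
    by (simp add: SUP_le_iff cl_norm_scaleR)
  \<comment> \<open>For R > 0 the closure of the open ball is the closed ball, and a closed set
    contains a set exactly if it contains its closure.\<close>
  have supp_iff: "?supp \<longleftrightarrow> (\<forall>A \<xi>. norm \<xi> > R \<longrightarrow> ft (?f A) \<xi> = 0)"
  proof -
    have "?supp \<longleftrightarrow> {\<xi>. fourier \<psi> \<xi> \<noteq> 0} \<subseteq> cball 0 R"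
      unfolding closure_ball[OF assms(3)]
      using closure_subset[of "{\<xi>. fourier \<psi> \<xi> \<noteq> 0}"]
        closure_minimal[of "{\<xi>. fourier \<psi> \<xi> \<noteq> 0}" "cball 0 R"] by blast
    also have "\<dots> \<longleftrightarrow> (\<forall>A \<xi>. norm \<xi> > R \<longrightarrow> ft (?f A) \<xi> = 0)"
      by (auto simp: subset_iff vec_eq_iff fourier_nth[OF assms(4)] not_le[symmetric])
    finally show ?thesis .
  qed
  show ?thesis
    unfolding supp_iff
  proof (intro iffI allI impI)
    fix m assume van: "\<forall>A \<xi>. norm \<xi> > R \<longrightarrow> ft (?f A) \<xi> = 0"
    have "\<exists>C\<ge>0. \<forall>k x. \<alpha> * real k > 2 * real m + 1 - real CARD('n) \<longrightarrow>
        (1 + (norm x)\<^sup>2) ^ m * cmod (symbol_integral \<alpha> k (?f A) x) \<le> C * R powr (\<alpha> * real k)" for A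
      by (rule symbol_integral_decay[OF schwartz van[rule_format] assms(1)])
    then obtain C where C: "\<And>A. C A \<ge> 0" "\<And>A k x. \<alpha> * real k > 2 * real m + 1 - real CARD('n) \<Longrightarrow>
        (1 + (norm x)\<^sup>2) ^ m * cmod (symbol_integral \<alpha> k (?f A) x) \<le> C A * R powr (\<alpha> * real k)"
      by metis
    \<comment> \<open>The summand 1 makes the constant strictly positive; 2^(n/2) comes from
      \<open>cl_norm\<close> and (2 pi)^n from the inverse transform.\<close>
    define \<Lambda> where "\<Lambda> = 1 + 2 powr (real CARD('n) / 2) * (\<Sum>A\<in>UNIV. C A / (2 * pi) ^ CARD('n))"
    have "(1 + (norm x)\<^sup>2) ^ m * cl_norm (frac_laplacian_power \<alpha> k \<psi> x) \<le> \<Lambda> * R powr (\<alpha> * real k)"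
      if k: "\<alpha> * real k > 2 * real m + 1 - real CARD('n)" for k x
    proof -
      have "(1 + (norm x)\<^sup>2) ^ m * cl_norm (frac_laplacian_power \<alpha> k \<psi> x)
          \<le> (1 + (norm x)\<^sup>2) ^ m * (2 powr (real CARD('n) / 2) * (\<Sum>A\<in>UNIV. cmod (frac_laplacian_power \<alpha> k \<psi> x $ A)))"
        by (intro mult_left_mono cl_norm_le_sum) auto
      also have "\<dots> = 2 powr (real CARD('n) / 2) *
          (\<Sum>A\<in>UNIV. (1 + (norm x)\<^sup>2) ^ m * cmod (symbol_integral \<alpha> k (?f A) x) / (2 * pi) ^ CARD('n))"
        unfolding nth sum_distrib_left times_divide_eq_right by (simp only: ac_simps)
      also have "\<dots> \<le> 2 powr (real CARD('n) / 2) * (\<Sum>A\<in>UNIV. C A * R powr (\<alpha> * real k) / (2 * pi) ^ CARD('n))"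
        by (intro mult_left_mono sum_mono divide_right_mono C k) auto
      also have "\<dots> = (\<Lambda> - 1) * R powr (\<alpha> * real k)"
        by (simp add: \<Lambda>_def sum_distrib_right sum_distrib_left mult_ac)
      also have "\<dots> \<le> \<Lambda> * R powr (\<alpha> * real k)"
        by (intro mult_right_mono) auto
      finally show ?thesis .
    qed
    moreover have "\<Lambda> > 0"
      unfolding \<Lambda>_def using C(1) by (intro add_pos_nonneg mult_nonneg_nonneg sum_nonneg) auto
    ultimately show "\<exists>\<Lambda>. ?bound m \<Lambda>"
      unfolding sup_iff by blast
  next
    fix A and \<xi> :: "real ^ 'n::{finite,linorder}" assume "\<forall>m. \<exists>\<Lambda>. ?bound m \<Lambda>" and \<xi>: "norm \<xi> > R"
    \<comment> \<open>The instance m = n, whose threshold 2 n + 1 - n is n + 1.\<close>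
    then obtain \<Lambda> where \<Lambda>: "\<And>k x. \<alpha> * real k > 2 * real CARD('n) + 1 - real CARD('n) \<Longrightarrow>
        (1 + (norm x)\<^sup>2) ^ CARD('n) * cl_norm (frac_laplacian_power \<alpha> k \<psi> x) \<le> \<Lambda> * R powr (\<alpha> * real k)"
      unfolding sup_iff by blast
    show "ft (?f A) \<xi> = 0"
    proof (rule ft_vanishes_if_symbol_integrals_bounded[OF schwartz assms(1-3) _ \<xi>])
      fix k and x :: "real ^ 'n::{finite,linorder}" assume k: "\<alpha> * real k > real CARD('n) + 1"
      have "(1 + (norm x)\<^sup>2) ^ CARD('n) * cmod (symbol_integral \<alpha> k (?f A) x)
          = (2 * pi) ^ CARD('n) * ((1 + (norm x)\<^sup>2) ^ CARD('n) * cmod (frac_laplacian_power \<alpha> k \<psi> x $ A))"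
        by (simp add: nth)
      also have "\<dots> \<le> (2 * pi) ^ CARD('n) * ((1 + (norm x)\<^sup>2) ^ CARD('n) * cl_norm (frac_laplacian_power \<alpha> k \<psi> x))"
        by (intro mult_left_mono cmod_nth_le_cl_norm) auto
      also have "\<dots> \<le> (2 * pi) ^ CARD('n) * (\<Lambda> * R powr (\<alpha> * real k))"
        using k by (intro mult_left_mono \<Lambda>) auto
      finally show "(1 + (norm x)\<^sup>2) ^ CARD('n) * cmod (symbol_integral \<alpha> k (?f A) x)
          \<le> ((2 * pi) ^ CARD('n) * \<Lambda>) * R powr (\<alpha> * real k)"
        by (simp add: mult.assoc)
    qed
  qed
qed

end
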